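(* Let $X\in\mathbb R^{n\times p}$ be deterministic, $\sigma>0$, and let $L=(\boldsymbol\lambda,\tau)$ be random positive scales with $\boldsymbol\lambda=(\lambda_1,\dots,\lambda_p)$. Conditional on $L$, let $\beta_1,\dots,\beta_p$ be independent with $\beta_j\mid\tau,\lambda_j\sim N(0,\tau^2\lambda_j^2)$, and let $Y\mid\beta,L\sim N(X\beta,\sigma^2I_n)$, so that $L\to\beta\to Y$ is a Markov chain. Put $\Sigma_{\lambda,\tau}=\mathrm{diag}(\tau^2\lambda_1^2,\dots,\tau^2\lambda_p^2)$. Then, conditional on a given value of $(\boldsymbol\lambda,\tau)$, the mutual information between $\beta$ and $Y$ equals \[ \frac12\log\det\left(I_n+\sigma^{-2}X\Sigma_{\lambda,\tau}X^\top\right), \] and the marginal mutual information satisfies \[ I(\beta;Y)=I(L;Y)+I(\beta;Y\mid L). \]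
   Context: $I(U;V)=\mathrm{KL}(P_{U,V}\,\|\,P_U\otimes P_V)$ is mutual information (natural logarithm), with values in $[0,\infty]$. $I(\beta;Y\mid L)$ is the conditional mutual information, i.e. the average over the law of $L$ of the mutual information between $\beta$ and $Y$ under their conditional joint law given $L$. *)

theory Defs
  imports "HOL-Probability.Probability"
begin

text \<open>
  The library's \<open>KL_divergence b Q P\<close> is the real-valued integral of \<open>log b (dP/dQ)\<close> against
  \<open>P\<close> (note the argument order), which is \<open>0\<close> by convention when the integral diverges. For
  probability measures with \<open>P \<lless> Q\<close> the negative part of \<open>ln (dP/dQ)\<close> is always
  \<open>P\<close>-integrable, so non-integrability means that the divergence is \<open>\<infinity>\<close>.
\<close>

definition KL :: "'a measure \<Rightarrow> 'a measure \<Rightarrow> ereal" where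
  "KL P Q =
    (if absolutely_continuous Q P \<and> integrable P (entropy_density (exp 1) Q P)
     then ereal (KL_divergence (exp 1) Q P) else \<infinity>)"

definition mutual_info ::
  "'o measure \<Rightarrow> 'u measure \<Rightarrow> 'v measure \<Rightarrow> ('o \<Rightarrow> 'u) \<Rightarrow> ('o \<Rightarrow> 'v) \<Rightarrow> ereal" where
  "mutual_info M S T U V =
    KL (distr M (S \<Otimes>\<^sub>M T) (\<lambda>x. (U x, V x))) (distr M S U \<Otimes>\<^sub>M distr M T V)"

text \<open>\<open>K\<close> is a regular conditional distribution of \<open>W\<close> (valued in \<open>T\<close>) given \<open>V\<close> (valued in \<open>S\<close>).\<close>

definition cond_law ::
  "'o measure \<Rightarrow> 'v measure \<Rightarrow> 'w measure \<Rightarrow> ('o \<Rightarrow> 'v) \<Rightarrow> ('o \<Rightarrow> 'w) \<Rightarrow> ('v \<Rightarrow> 'w measure) \<Rightarrow> bool"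
where
  "cond_law M S T V W K \<longleftrightarrow>
    K \<in> S \<rightarrow>\<^sub>M prob_algebra T \<and>
    (\<forall>A\<in>sets S. \<forall>B\<in>sets T.
      emeasure M {x \<in> space M. V x \<in> A \<and> W x \<in> B} = (\<integral>\<^sup>+v\<in>A. emeasure (K v) B \<partial>distr M S V))"

text \<open>
  On countably generated spaces (such as Euclidean ones) regular conditional distributions are
  unique up to null sets of the law of \<open>Z\<close>, so the choice below does not affect the value.
\<close>

definition cond_mutual_info ::
  "'o measure \<Rightarrow> 'u measure \<Rightarrow> 'v measure \<Rightarrow> 'z measure \<Rightarrow>
    ('o \<Rightarrow> 'u) \<Rightarrow> ('o \<Rightarrow> 'v) \<Rightarrow> ('o \<Rightarrow> 'z) \<Rightarrow> ereal" where
  "cond_mutual_info M S T R U V Z =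
    (let K = (SOME K. cond_law M R (S \<Otimes>\<^sub>M T) Z (\<lambda>x. (U x, V x)) K)
     in enn2ereal (\<integral>\<^sup>+z. e2ennreal (mutual_info (K z) S T fst snd) \<partial>distr M R Z))"

text \<open>Independent coordinates, the \<open>i\<close>-th one normal with mean \<open>m $ i\<close> and standard deviation \<open>s $ i > 0\<close>.\<close>

definition normal_vec :: "real ^ 'k \<Rightarrow> real ^ 'k \<Rightarrow> (real ^ 'k) measure" where
  "normal_vec m s =
    distr (\<Pi>\<^sub>M i\<in>UNIV. density lborel (\<lambda>x. ennreal (normal_density (m $ i) (s $ i) x))) borel vec_lambda"

definition scale_space :: "((real ^ 'p) \<times> real) measure" where
  "scale_space = restrict_space borel {(lam, tau). 0 < tau \<and> (\<forall>j. 0 < lam $ j)}"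

definition prior :: "(real ^ 'p) \<times> real \<Rightarrow> (real ^ 'p) measure" where
  "prior = (\<lambda>(lam, tau). normal_vec 0 (\<chi> j. tau * lam $ j))"

definition likelihood :: "real ^ 'p ^ 'n \<Rightarrow> real \<Rightarrow> real ^ 'p \<Rightarrow> (real ^ 'n) measure" where
  "likelihood X \<sigma> b = normal_vec (X *v b) (\<chi> i. \<sigma>)"

definition joint_given ::
  "real ^ 'p ^ 'n \<Rightarrow> real \<Rightarrow> (real ^ 'p) \<times> real \<Rightarrow> ((real ^ 'p) \<times> (real ^ 'n)) measure" where
  "joint_given X \<sigma> l =
    prior l \<bind> (\<lambda>b. distr (likelihood X \<sigma> b) (borel \<Otimes>\<^sub>M borel) (\<lambda>y. (b, y)))"

definition Sigma_scales :: "real ^ 'p \<Rightarrow> real \<Rightarrow> real ^ 'p ^ 'p" where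
  "Sigma_scales lam tau = (\<chi> i j. if i = j then tau\<^sup>2 * (lam $ i)\<^sup>2 else 0)"

end

theory Submission
  imports Defs
begin

text \<open>
  The kernel \<open>f (y | b)\<close> of \<open>Y\<close> given \<open>\<beta>\<close> is a bounded positive Lebesgue density that does not depend on the
  scales. With \<open>h (y | l)\<close> and \<open>g (y)\<close> its mixtures over \<open>\<beta> | L = l\<close> and over \<open>\<beta>\<close>, the three mutual informations
  are the expectations of \<open>ln (f/g)\<close>, \<open>ln (h/g)\<close> and \<open>ln (f/h)\<close>, and the chain rule is the additivity of the
  logarithm; no density of \<open>\<beta>\<close> is needed, and since \<open>- ln t \<le> 1/t - 1\<close> all negative parts have integral at
  most 1.

  For the closed form, integrating out one coefficient \<open>\<beta>\<^sub>j\<close> is a one-dimensional Gaussian integral that adds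
  \<open>\<tau>\<^sup>2 \<lambda>\<^sub>j\<^sup>2 x\<^sub>j x\<^sub>j\<^sup>T\<close> to the covariance, by the Sherman--Morrison formula and the matrix determinant lemma. So
  \<open>h (\<cdot> | l)\<close> is the centered Gaussian density with covariance \<open>C = \<sigma>\<^sup>2 I + X \<Sigma> X\<^sup>T\<close>. The quadratic forms in
  \<open>ln f\<close> and \<open>ln h\<close> both have expectation \<open>n\<close>, the latter because it is the trace of \<open>C\<^sup>-\<^sup>1 C\<close>, which leaves only the log determinants.
\<close>

section \<open>Rank-one updates of positive definite matrices\<close>

text \<open>No moment of the scales is assumed, so the chain rule may read infinity = infinity and
  expectations of logarithms cannot be subtracted freely. Integrals are therefore kept in
  [0, infinity], and the bound on the negative parts is what permits cancelling them at the end.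
  Pairs are measured against the law of the first component times Lebesgue measure. In this frame
  the product of the marginals has a density that depends on the second component alone, so all
  three likelihood ratios have the same shape, and \<open>mutual_info_density\<close> serves for
  (\<beta>, Y), for (L, Y) and for the conditional law given L. The encoding adds two obligations.
  \<open>cond_law\<close> speaks of rectangles only and has to be extended to integrals;
  \<open>cond_mutual_info\<close> integrates over a kernel picked by choice, so almost sure
  uniqueness of conditional laws is needed before an explicit kernel can replace it. The Markov
  property is the fact that the kernel of Y ignores its argument \<open>l\<close>.\<close>

lemma det_identity_replace_row:
  fixes v :: "real ^ 'n"
  shows "det (\<chi> i. if i = k then v else axis i 1) = v $ k"
proof -
  \<comment> \<open>The vector \<open>v\<close> is the combination of the rows of the identity with
    coefficients \<open>v $ i\<close>, which is the shape in which Cramer's rule applies.\<close>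
  have "(\<chi> i. if i = k then v else axis i 1) =
      ((\<chi> i. if i = k then \<Sum>i\<in>UNIV. v $ i *s row i (mat 1) else row i (mat 1)) :: real^'n^'n)"
    by (auto simp: vec_eq_iff row_def mat_def axis_def if_distrib cong: if_cong)
  then show ?thesis
    using cramer_lemma_transpose[of k v "mat 1"] by simp
qed

text \<open>The rows are updated one at a time, with \<open>S\<close> the set of rows already
  updated; updating row \<open>k\<close> increases the determinant by
  \<open>u $ k * v $ k\<close>.\<close>

lemma det_identity_rank_one_update:
  fixes u v :: "real ^ 'n"
  shows "det (\<chi> i j. (if i = j then 1 else 0) + u $ i * v $ j) = 1 + u \<bullet> v"
proof -
  let ?c = "\<lambda>S i. if i \<in> S then axis i 1 + u $ i *s v else axis i 1 :: real ^ 'n"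
  \<comment> \<open>With row \<open>k\<close> equal to \<open>v\<close>, the updates of the other
    rows add multiples of row \<open>k\<close>, which leaves the determinant unchanged.\<close>
  have replaced: "det (\<chi> i. if i = k then v else ?c S i) = v $ k" if "finite S" "k \<notin> S" for S k
    using that
  proof (induction S)
    case empty
    then show ?case by (simp add: det_identity_replace_row cong: if_cong)
  next
    case (insert j S)
    let ?A = "\<chi> i. if i = k then v else ?c S i"
    have "(\<chi> i. if i = k then v else ?c (insert j S) i) =
        (\<chi> l. if l = j then row j ?A + u $ j *s row k ?A else row l ?A)"
      using insert.hyps insert.prems by (auto simp: vec_eq_iff row_def)
    then show ?case
      using insert det_row_operation[of j k ?A "u $ j"] by auto
  qed
  \<comment> \<open>Linearity in row \<open>k\<close> splits the new determinant into the previous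
    one and \<open>u $ k\<close> times the determinant with row \<open>k\<close> replaced by
    \<open>v\<close>.\<close>
  have "det (\<chi> i. ?c S i) = 1 + (\<Sum>i\<in>S. u $ i * v $ i)" if "finite S" for S
    using that
  proof (induction S)
    case empty
    have "(\<chi> i. axis i 1) = (mat 1 :: real^'n^'n)"
      by (auto simp: vec_eq_iff mat_def axis_def)
    then show ?case by simp
  next
    case (insert k S)
    have "(\<chi> i. ?c (insert k S) i) = (\<chi> i. if i = k then axis k 1 + u $ k *s v else ?c S i)"
      using insert.hyps by (auto simp: vec_eq_iff)
    moreover have "(\<chi> i. if i = k then axis k 1 else ?c S i) = (\<chi> i. ?c S i)"
      using insert.hyps by (auto simp: vec_eq_iff)
    ultimately show ?case
      using insert det_row_add[of k "\<lambda>_. axis k 1" "\<lambda>_. u $ k *s v" "?c S"]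
        det_row_mul[of k "u $ k" "\<lambda>_. v" "?c S"] replaced[of S k]
      by simp
  qed
  note this[of UNIV]
  moreover have "(\<chi> i j. (if i = j then 1 else 0) + u $ i * v $ j) = (\<chi> i. ?c UNIV i)"
    by (simp add: vec_eq_iff axis_def eq_commute)
  ultimately show ?thesis
    by (simp add: inner_vec_def)
qed

definition outer :: "real ^ 'n \<Rightarrow> real ^ 'm \<Rightarrow> real ^ 'm ^ 'n" where
  "outer u v = (\<chi> i j. u $ i * v $ j)"

lemma outer_mult_vec: "outer u v *v x = (v \<bullet> x) *\<^sub>R u"
  by (simp add: outer_def matrix_vector_mult_def vec_eq_iff inner_vec_def sum_distrib_left algebra_simps)

lemma matrix_mult_outer: "C ** outer u v = outer (C *v u) v"
  by (simp add: outer_def matrix_vector_mult_def matrix_matrix_mult_def vec_eq_iff sum_distrib_left sum_distrib_right mult_ac)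

text \<open>Factoring out \<open>C\<close> turns the update into C (I + (P u) v^T), which reduces
  the claim to the identity matrix.\<close>

lemma det_rank_one_update:
  fixes C P :: "real ^ 'n ^ 'n"
  assumes "C ** P = mat 1"
  shows "det (C + outer u v) = det C * (1 + v \<bullet> (P *v u))"
proof -
  have "C *v (P *v u) = u"
    by (simp add: matrix_vector_mul_assoc assms)
  then have "C + outer u v = C ** (mat 1 + outer (P *v u) v)"
    by (simp add: matrix_add_ldistrib matrix_mult_outer)
  moreover have "det (mat 1 + outer (P *v u) v) = 1 + (P *v u) \<bullet> v"
  proof -
    have "mat 1 + outer (P *v u) v = (\<chi> i j. (if i = j then 1 else 0) + (P *v u) $ i * v $ j)"
      by (simp add: vec_eq_iff outer_def mat_def)
    then show ?thesis by (simp only: det_identity_rank_one_update)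
  qed
  ultimately show ?thesis by (simp add: det_mul inner_commute)
qed

text \<open>For symmetric matrices this is positive definiteness; the determinant form is what the rank-one update preserves directly.\<close>

definition psd :: "real ^ 'n ^ 'n \<Rightarrow> bool" where
  "psd C \<longleftrightarrow> transpose C = C \<and> (\<forall>x. 0 \<le> x \<bullet> (C *v x)) \<and> 0 < det C"

lemma psd_inverse:
  assumes "psd C"
  shows "C ** matrix_inv C = mat 1" "matrix_inv C ** C = mat 1"
    "transpose (matrix_inv C) = matrix_inv C" "0 \<le> x \<bullet> (matrix_inv C *v x)"
proof -
  have inv: "invertible C"
    using assms by (simp add: psd_def invertible_det_nz)
  then have "C ** matrix_inv C = mat 1 \<and> matrix_inv C ** C = mat 1"
    unfolding matrix_inv_def invertible_def by (rule someI_ex)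
  then show r: "C ** matrix_inv C = mat 1" and l: "matrix_inv C ** C = mat 1"
    by simp_all
  have "transpose (matrix_inv C) ** C = mat 1"
    by (metis assms matrix_transpose_mul psd_def r transpose_mat)
  then show "transpose (matrix_inv C) = matrix_inv C"
    by (metis matrix_mul_assoc matrix_mul_lid matrix_mul_rid r)
  \<comment> \<open>With z = C^-1 x, the form of the inverse at x is the form of \<open>C\<close> at
    z.\<close>
  have "x = C *v (matrix_inv C *v x)"
    by (simp add: matrix_vector_mul_assoc r)
  then show "0 \<le> x \<bullet> (matrix_inv C *v x)"
    using assms by (metis inner_commute psd_def)
qed

lemma symmetric_inner: "transpose P = P \<Longrightarrow> x \<bullet> (P *v y) = (P *v x) \<bullet> (y :: real ^ 'n)"
  by (metis dot_lmul_matrix transpose_matrix_vector)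

lemma psd_rank_one_update:
  fixes C :: "real ^ 'n ^ 'n" and v :: "real ^ 'n"
  assumes C: "psd C" and "0 \<le> t"
  defines "P \<equiv> matrix_inv C"
  defines "a \<equiv> v \<bullet> (P *v v)"
  shows "det (C + t *\<^sub>R outer v v) = det C * (1 + t * a)"
    and "psd (C + t *\<^sub>R outer v v)"
    and "matrix_inv (C + t *\<^sub>R outer v v) = P - (t / (1 + t * a)) *\<^sub>R outer (P *v v) (P *v v)"
proof -
  note P = psd_inverse[OF C, folded P_def]
  have a: "0 \<le> t * a" using P(4) \<open>0 \<le> t\<close> by (simp add: a_def)
  have out: "t *\<^sub>R outer v v = outer (t *\<^sub>R v) v"
    by (simp add: outer_def vec_eq_iff)
  show det: "det (C + t *\<^sub>R outer v v) = det C * (1 + t * a)"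
    unfolding out det_rank_one_update[OF P(1)]
    by (simp add: a_def matrix_vector_mult_scaleR)
  show "psd (C + t *\<^sub>R outer v v)"
    unfolding psd_def
  proof (intro conjI allI)
    show "transpose (C + t *\<^sub>R outer v v) = C + t *\<^sub>R outer v v"
      using C by (simp add: psd_def transpose_def outer_def vec_eq_iff mult.commute)
    have "x \<bullet> ((C + t *\<^sub>R outer v v) *v x) = x \<bullet> (C *v x) + t * (v \<bullet> x)\<^sup>2" for x
      by (simp add: matrix_vector_mult_add_rdistrib scaleR_matrix_vector_assoc[symmetric] outer_mult_vec
          inner_add_right inner_commute power2_eq_square mult.assoc)
    then show "0 \<le> x \<bullet> ((C + t *\<^sub>R outer v v) *v x)" for x
      using C \<open>0 \<le> t\<close> by (simp add: psd_def)
    show "0 < det (C + t *\<^sub>R outer v v)"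
      unfolding det using C a by (simp add: psd_def)
  qed
  then have inv: "(C + t *\<^sub>R outer v v) ** matrix_inv (C + t *\<^sub>R outer v v) = mat 1"
    "matrix_inv (C + t *\<^sub>R outer v v) ** (C + t *\<^sub>R outer v v) = mat 1"
    by (rule psd_inverse)+
  \<comment> \<open>The product of the two matrices is the identity plus (t - r - t r a) times v (P
    v)^T; \<open>r\<close> is the coefficient that makes this term vanish.\<close>
  define r where "r = t / (1 + t * a)"
  have r: "t - r - t * r * a = 0" using a by (simp add: r_def field_simps)
  have "((C + t *\<^sub>R outer v v) ** (P - r *\<^sub>R outer (P *v v) (P *v v))) *v x = x" for x
  proof -
    have "C *v (P *v y) = y" for y
      by (simp add: matrix_vector_mul_assoc P)
    moreover have "v \<bullet> (P *v x) = (P *v v) \<bullet> x"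
      by (rule symmetric_inner[OF P(3)])
    ultimately have "((C + t *\<^sub>R outer v v) ** (P - r *\<^sub>R outer (P *v v) (P *v v))) *v x =
        x + ((t - r - t * r * a) * ((P *v v) \<bullet> x)) *\<^sub>R v"
      by (simp add: matrix_vector_mul_assoc[symmetric] matrix_vector_mult_add_rdistrib matrix_vector_mult_diff_rdistrib
          matrix_vector_mult_diff_distrib scaleR_matrix_vector_assoc[symmetric] outer_mult_vec
          matrix_vector_mult_scaleR inner_diff_right a_def algebra_simps)
    then show ?thesis by (simp add: r)
  qed
  then have "(C + t *\<^sub>R outer v v) ** (P - r *\<^sub>R outer (P *v v) (P *v v)) = mat 1"
    by (simp add: matrix_eq)
  with inv(2) show "matrix_inv (C + t *\<^sub>R outer v v) = P - (t / (1 + t * a)) *\<^sub>R outer (P *v v) (P *v v)"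
    unfolding r_def by (metis matrix_mul_assoc matrix_mul_lid matrix_mul_rid)
qed

section \<open>Gaussian densities and their mixtures\<close>

text \<open>The density of N(0, C) when \<open>C\<close> satisfies \<open>psd\<close>; a mean m
  enters as a shift of the argument, \<open>gauss C (y - m)\<close>.\<close>

definition gauss :: "real ^ 'n ^ 'n \<Rightarrow> real ^ 'n \<Rightarrow> real" where
  "gauss C y = exp (- (y \<bullet> (matrix_inv C *v y)) / 2) / sqrt ((2 * pi) ^ CARD('n) * det C)"

lemma gauss_measurable [measurable]: "gauss C \<in> borel_measurable borel"
proof -
  have [measurable]: "(\<lambda>y. y \<bullet> (matrix_inv C *v y)) \<in> borel_measurable borel"
    by (intro borel_measurable_continuous_onI continuous_intros)
  show ?thesis unfolding gauss_def[abs_def] by measurable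
qed

lemma gauss_nonneg: "psd C \<Longrightarrow> 0 \<le> gauss C y"
  by (simp add: gauss_def psd_def)

lemma gauss_pos: "psd C \<Longrightarrow> 0 < gauss C y"
  by (simp add: gauss_def psd_def)

text \<open>This is Bayes' rule for one coefficient t with prior N(0, s^2) and data y distributed as
  N(t v, C): prior times likelihood equals marginal of y times posterior of t. Completing the square
  in t gives the posterior precision 1/r^2 = 1/s^2 + a and the posterior mean r^2 c.\<close>

lemma normal_density_mult_gauss:
  fixes C :: "real ^ 'n ^ 'n" and v y :: "real ^ 'n" and s :: real
  assumes C: "psd C" and s: "0 < s"
  defines "a \<equiv> v \<bullet> (matrix_inv C *v v)" and "c \<equiv> v \<bullet> (matrix_inv C *v y)"
  defines "r \<equiv> s / sqrt (1 + s\<^sup>2 * a)"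
  shows "normal_density 0 s t * gauss C (y - t *\<^sub>R v) =
      gauss (C + s\<^sup>2 *\<^sub>R outer v v) y * normal_density (r\<^sup>2 * c) r t"
proof -
  let ?P = "matrix_inv C"
  note P = psd_inverse[OF C]
  have a: "0 \<le> a" by (simp add: a_def P)
  define k where "k = 1 + s\<^sup>2 * a"
  have k: "0 < k" using a by (simp add: k_def add_pos_nonneg)
  have r2: "r\<^sup>2 = s\<^sup>2 / k"
    using k by (simp add: r_def k_def power_divide)
  have r: "0 < r" using s k by (simp add: r_def k_def)
  note upd = psd_rank_one_update[OF C, of "s\<^sup>2" v, simplified, folded a_def, folded k_def]
  have Pv: "(?P *v v) \<bullet> y = c" "y \<bullet> (?P *v v) = c"
    using symmetric_inner[OF P(3), of v y] by (simp_all add: c_def inner_commute)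
  have e1: "(y - t *\<^sub>R v) \<bullet> (?P *v (y - t *\<^sub>R v)) = y \<bullet> (?P *v y) - 2 * t * c + t\<^sup>2 * a"
    using Pv by (simp add: matrix_vector_mult_diff_distrib matrix_vector_mult_scaleR inner_diff_left inner_diff_right
        a_def c_def[symmetric] power2_eq_square algebra_simps)
  have e2: "y \<bullet> (matrix_inv (C + s\<^sup>2 *\<^sub>R outer v v) *v y) = y \<bullet> (?P *v y) - r\<^sup>2 * c\<^sup>2"
    using Pv by (simp add: upd(3) matrix_vector_mult_diff_rdistrib scaleR_matrix_vector_assoc[symmetric] outer_mult_vec
        inner_diff_right r2) (simp add: power2_eq_square)
  have "- t\<^sup>2 / (2 * s\<^sup>2) + - (y \<bullet> (?P *v y) - 2 * t * c + t\<^sup>2 * a) / 2 =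
      - (y \<bullet> (?P *v y) - r\<^sup>2 * c\<^sup>2) / 2 + - (t - r\<^sup>2 * c)\<^sup>2 / (2 * r\<^sup>2)"
  proof -
    have "t\<^sup>2 / s\<^sup>2 + t\<^sup>2 * a = t\<^sup>2 / r\<^sup>2"
      using s by (simp add: r2 k_def field_simps)
    moreover have "(t - r\<^sup>2 * c)\<^sup>2 / r\<^sup>2 = t\<^sup>2 / r\<^sup>2 - 2 * t * c + r\<^sup>2 * c\<^sup>2"
      using r by (simp add: power2_diff field_simps power2_eq_square)
    ultimately show ?thesis
      by (simp add: field_simps)
  qed
  then have exps: "exp (- t\<^sup>2 / (2 * s\<^sup>2)) * exp (- (y \<bullet> (?P *v y) - 2 * t * c + t\<^sup>2 * a) / 2) =
      exp (- (y \<bullet> (?P *v y) - r\<^sup>2 * c\<^sup>2) / 2) * exp (- (t - r\<^sup>2 * c)\<^sup>2 / (2 * r\<^sup>2))"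
    by (simp only: exp_add[symmetric])
  \<comment> \<open>For the normalizing constants, the determinant lemma contributes the factor
    \<open>k\<close>, and the posterior variance s^2 / k absorbs it.\<close>
  have "(2 * pi * s\<^sup>2) * ((2 * pi) ^ CARD('n) * det C) = ((2 * pi) ^ CARD('n) * (det C * k)) * (2 * pi * r\<^sup>2)"
    using k by (simp add: r2)
  then have roots: "sqrt (2 * pi * s\<^sup>2) * sqrt ((2 * pi) ^ CARD('n) * det C) =
      sqrt ((2 * pi) ^ CARD('n) * (det C * k)) * sqrt (2 * pi * r\<^sup>2)"
    by (simp only: real_sqrt_mult[symmetric])
  show ?thesis
    unfolding gauss_def normal_density_def e1 e2 upd(1)
    using exps roots by (simp add: divide_simps mult_ac) 
qed

text \<open>The posterior factor in \<open>normal_density_mult_gauss\<close> integrates to 1, so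
  only the marginal of y is left.\<close>

lemma nn_integral_normal_gauss:
  fixes C :: "real ^ 'n ^ 'n"
  assumes C: "psd C" and s: "0 < s"
  shows "(\<integral>\<^sup>+t. ennreal (gauss C (y - t *\<^sub>R v)) \<partial>density lborel (\<lambda>t. ennreal (normal_density 0 s t))) =
    ennreal (gauss (C + s\<^sup>2 *\<^sub>R outer v v) y)"
proof -
  define a where "a = v \<bullet> (matrix_inv C *v v)"
  define r where "r = s / sqrt (1 + s\<^sup>2 * a)"
  define m where "m = r\<^sup>2 * (v \<bullet> (matrix_inv C *v y))"
  have "0 \<le> a" using psd_inverse[OF C] by (simp add: a_def)
  then have r: "0 < r" using s by (simp add: r_def add_pos_nonneg)
  note C' = psd_rank_one_update(2)[OF C, of "s\<^sup>2" v, simplified]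
  have "(\<integral>\<^sup>+t. ennreal (gauss C (y - t *\<^sub>R v)) \<partial>density lborel (\<lambda>t. ennreal (normal_density 0 s t))) =
      (\<integral>\<^sup>+t. ennreal (normal_density 0 s t * gauss C (y - t *\<^sub>R v)) \<partial>lborel)"
    by (subst nn_integral_density) (auto simp: ennreal_mult' gauss_nonneg[OF C])
  also have "\<dots> = (\<integral>\<^sup>+t. ennreal (gauss (C + s\<^sup>2 *\<^sub>R outer v v) y) * ennreal (normal_density m r t) \<partial>lborel)"
    unfolding normal_density_mult_gauss[OF C s] m_def r_def a_def
    by (simp add: ennreal_mult' gauss_nonneg[OF C'])
  also have "\<dots> = ennreal (gauss (C + s\<^sup>2 *\<^sub>R outer v v) y)"
    using r by (simp add: nn_integral_cmult nn_integral_eq_integral)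
  finally show ?thesis .
qed

lemma psd_add_outer_sum:
  "finite S \<Longrightarrow> psd C \<Longrightarrow> psd (C + (\<Sum>j\<in>S. (s j)\<^sup>2 *\<^sub>R outer (w j) (w j)))"
proof (induction S rule: finite_induct)
  case (insert i S)
  then show ?case
    using psd_rank_one_update(2)[of "C + (\<Sum>j\<in>S. (s j)\<^sup>2 *\<^sub>R outer (w j) (w j))" "(s i)\<^sup>2" "w i"]
    by (simp add: algebra_simps)
qed simp

text \<open>The coordinates are integrated out one by one. The induction keeps \<open>y\<close>
  arbitrary because the inner integral is needed at the shifted point y - t w_i; the outer integral
  is the one-dimensional case, with the covariance accumulated so far in place of
  \<open>C\<close>.\<close>

lemma nn_integral_PiM_gauss:
  fixes C :: "real ^ 'n ^ 'n" and w :: "'i \<Rightarrow> real ^ 'n"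
  assumes "finite S" and C: "psd C" and s: "\<And>j. 0 < s j"
  shows "(\<integral>\<^sup>+x. ennreal (gauss C (y - (\<Sum>j\<in>S. x j *\<^sub>R w j)))
      \<partial>(\<Pi>\<^sub>M j\<in>S. density lborel (\<lambda>t. ennreal (normal_density 0 (s j) t)))) =
    ennreal (gauss (C + (\<Sum>j\<in>S. (s j)\<^sup>2 *\<^sub>R outer (w j) (w j))) y)"
  using \<open>finite S\<close>
proof (induction S arbitrary: y rule: finite_induct)
  case empty
  show ?case by (simp add: PiM_empty nn_integral_count_space_finite)
next
  case (insert i S)
  let ?N = "\<lambda>j. density lborel (\<lambda>t. ennreal (normal_density 0 (s j) t))"
  interpret prob_space "?N j" for j
    using s by (rule prob_space_normal_density)
  interpret product_sigma_finite ?N ..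
  have [measurable]: "(\<lambda>x. x j) \<in> borel_measurable (Pi\<^sub>M (insert i S) ?N)" if "j \<in> insert i S" for j
    using measurable_component_singleton[OF that, of ?N] by simp
  have "(\<integral>\<^sup>+x. ennreal (gauss C (y - (\<Sum>j\<in>insert i S. x j *\<^sub>R w j))) \<partial>Pi\<^sub>M (insert i S) ?N) =
      (\<integral>\<^sup>+t. \<integral>\<^sup>+x. ennreal (gauss C (y - (\<Sum>j\<in>insert i S. (x(i := t)) j *\<^sub>R w j))) \<partial>Pi\<^sub>M S ?N \<partial>?N i)"
    using insert.hyps by (subst product_nn_integral_insert_rev) auto
  also have "\<dots> = (\<integral>\<^sup>+t. \<integral>\<^sup>+x. ennreal (gauss C ((y - t *\<^sub>R w i) - (\<Sum>j\<in>S. x j *\<^sub>R w j))) \<partial>Pi\<^sub>M S ?N \<partial>?N i)"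
  proof (intro nn_integral_cong)
    fix t x
    have "(\<Sum>j\<in>S. (x(i := t)) j *\<^sub>R w j) = (\<Sum>j\<in>S. x j *\<^sub>R w j)"
      using insert.hyps by (intro sum.cong) auto
    then show "ennreal (gauss C (y - (\<Sum>j\<in>insert i S. (x(i := t)) j *\<^sub>R w j))) =
        ennreal (gauss C ((y - t *\<^sub>R w i) - (\<Sum>j\<in>S. x j *\<^sub>R w j)))"
      using insert.hyps by (simp add: algebra_simps)
  qed
  also have "\<dots> = ennreal (gauss (C + (\<Sum>j\<in>insert i S. (s j)\<^sup>2 *\<^sub>R outer (w j) (w j))) y)"
    unfolding insert.IH
    using insert.hyps nn_integral_normal_gauss[OF psd_add_outer_sum[OF insert.hyps(1) C] s]
    by (simp add: algebra_simps)
  finally show ?case .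
qed

lemma psd_scaled_identity:
  fixes \<sigma> :: real
  assumes "0 < \<sigma>"
  shows "det (\<sigma>\<^sup>2 *\<^sub>R mat 1 :: real ^ 'n ^ 'n) = \<sigma> ^ (2 * CARD('n))"
    and "psd (\<sigma>\<^sup>2 *\<^sub>R mat 1 :: real ^ 'n ^ 'n)"
    and "matrix_inv (\<sigma>\<^sup>2 *\<^sub>R mat 1 :: real ^ 'n ^ 'n) = (1 / \<sigma>\<^sup>2) *\<^sub>R mat 1"
proof -
  let ?C = "\<sigma>\<^sup>2 *\<^sub>R mat 1 :: real ^ 'n ^ 'n"
  have "?C = (\<chi> i. \<sigma>\<^sup>2 *s row i (mat 1))"
    by (simp add: vec_eq_iff row_def)
  then show d: "det ?C = \<sigma> ^ (2 * CARD('n))"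
    using det_rows_mul[of "\<lambda>_::'n. \<sigma>\<^sup>2" "\<lambda>i. row i (mat 1 :: real ^ 'n ^ 'n)"]
    by (simp add: row_def vec_lambda_eta power_mult)
  then show C: "psd ?C"
    using assms
    by (simp add: psd_def transpose_scalar transpose_mat scaleR_matrix_vector_assoc[symmetric])
  have "?C ** ((1 / \<sigma>\<^sup>2) *\<^sub>R mat 1) = mat 1"
    using assms by (simp add: matrix_eq matrix_vector_mul_assoc[symmetric] scaleR_matrix_vector_assoc[symmetric])
  then show "matrix_inv ?C = (1 / \<sigma>\<^sup>2) *\<^sub>R mat 1"
    by (metis psd_inverse(2)[OF C] matrix_mul_assoc matrix_mul_lid matrix_mul_rid)
qed

text \<open>Rewrites independent noise of equal variance as a quadratic form, so that the mixture
  lemmas can start from the covariance sigma^2 I.\<close>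

lemma prod_normal_density_eq_gauss:
  fixes m y :: "real ^ 'n"
  assumes "0 < \<sigma>"
  shows "(\<Prod>i\<in>UNIV. normal_density (m $ i) \<sigma> (y $ i)) = gauss (\<sigma>\<^sup>2 *\<^sub>R mat 1) (y - m)"
proof -
  have "(\<Prod>i\<in>UNIV. normal_density (m $ i) \<sigma> (y $ i)) =
      exp (\<Sum>i\<in>UNIV. - (y $ i - m $ i)\<^sup>2 / (2 * \<sigma>\<^sup>2)) / sqrt (2 * pi * \<sigma>\<^sup>2) ^ CARD('n)"
    by (simp add: normal_density_def exp_sum prod_dividef power_one_over prod.distrib)
  moreover have "(\<Sum>i\<in>UNIV. - (y $ i - m $ i)\<^sup>2 / (2 * \<sigma>\<^sup>2)) =
      - ((y - m) \<bullet> (matrix_inv (\<sigma>\<^sup>2 *\<^sub>R mat 1) *v (y - m))) / 2"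
    by (simp add: psd_scaled_identity[OF assms] scaleR_matrix_vector_assoc[symmetric] inner_vec_def sum_negf
        sum_divide_distrib) (simp add: power2_eq_square mult.commute)
  moreover have "sqrt (2 * pi * \<sigma>\<^sup>2) ^ CARD('n) = sqrt ((2 * pi) ^ CARD('n) * det (\<sigma>\<^sup>2 *\<^sub>R mat 1 :: real ^ 'n ^ 'n))"
    by (simp add: psd_scaled_identity[OF assms] power_mult real_sqrt_power[symmetric] power_mult_distrib del: real_sqrt_mult)
  ultimately show ?thesis
    by (simp add: gauss_def)
qed

section \<open>Lebesgue densities of normal vectors\<close>

lemma measurable_vec_lambda [measurable]:
  "vec_lambda \<in> (\<Pi>\<^sub>M i\<in>UNIV. borel) \<rightarrow>\<^sub>M (borel :: (real ^ 'n) measure)"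
proof -
  have "(\<lambda>x. vec_lambda x \<bullet> b) \<in> borel_measurable (\<Pi>\<^sub>M i\<in>UNIV. borel)"
    if "b \<in> Basis" for b :: "real ^ 'n"
  proof -
    obtain i where "b = axis i 1" using \<open>b \<in> Basis\<close> by (auto simp: Basis_vec_def)
    then show ?thesis by (simp add: inner_axis)
  qed
  then show ?thesis by (subst borel_measurable_euclidean_space) blast
qed

text \<open>Lebesgue measure is determined by its values on boxes, and the preimage of a box is a
  product of intervals, whose measure is the product of the side lengths.\<close>

lemma distr_PiM_lborel_vec_lambda:
  "distr (\<Pi>\<^sub>M i\<in>UNIV. lborel) borel vec_lambda = (lborel :: (real ^ 'n) measure)"
proof (rule lborel_eqI[symmetric])
  interpret product_sigma_finite "\<lambda>_::'n. lborel :: real measure" ..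
  fix l u :: "real ^ 'n"
  assume le: "\<And>b. b \<in> Basis \<Longrightarrow> l \<bullet> b \<le> u \<bullet> b"
  have le': "l $ i \<le> u $ i" for i
    using le[of "axis i 1"] by (simp add: axis_in_Basis_iff inner_axis)
  have "vec_lambda -` box l u \<inter> space (\<Pi>\<^sub>M i\<in>UNIV. lborel) = (\<Pi>\<^sub>E i\<in>UNIV. box (l $ i) (u $ i))"
    by (auto simp: space_PiM box_def Basis_vec_def inner_axis Pi_iff PiE_iff)
  moreover have "(\<Prod>b\<in>Basis. (u - l) \<bullet> b) = (\<Prod>i\<in>UNIV. (u - l) $ i)"
  proof -
    have "bij_betw (\<lambda>i. axis i 1 :: real ^ 'n) UNIV Basis"
      by (auto simp: bij_betw_def Basis_vec_def inj_on_def axis_eq_axis)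
    from prod.reindex_bij_betw[OF this, of "\<lambda>b. (u - l) \<bullet> b"] show ?thesis
      by (simp add: inner_axis)
  qed
  ultimately show "emeasure (distr (\<Pi>\<^sub>M i\<in>UNIV. lborel) borel vec_lambda) (box l u) =
      ennreal (\<Prod>b\<in>Basis. (u - l) \<bullet> b)"
    using le' by (simp add: emeasure_distr emeasure_PiM prod_ennreal cong: measurable_cong_sets sets_PiM_cong)
qed simp

text \<open>A product measure is determined by its values on rectangles. There the indicator factors
  over the coordinates, so the integral of the product of densities splits.\<close>

lemma (in product_sigma_finite) PiM_density:
  assumes "finite I"
    and [measurable]: "\<And>i. i \<in> I \<Longrightarrow> f i \<in> borel_measurable (M i)"
    and fin: "\<And>i. sigma_finite_measure (density (M i) (f i))"
  shows "(\<Pi>\<^sub>M i\<in>I. density (M i) (f i)) = density (Pi\<^sub>M I M) (\<lambda>x. \<Prod>i\<in>I. f i (x i))"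
proof -
  interpret D: product_sigma_finite "\<lambda>i. density (M i) (f i)"
    using fin by (simp add: product_sigma_finite_def)
  show ?thesis
  proof (rule D.PiM_eqI[OF \<open>finite I\<close>, symmetric])
    show "sets (density (Pi\<^sub>M I M) (\<lambda>x. \<Prod>i\<in>I. f i (x i))) = sets (\<Pi>\<^sub>M i\<in>I. density (M i) (f i))"
      by (simp cong: sets_PiM_cong)
    fix A assume "\<And>i. i \<in> I \<Longrightarrow> A i \<in> sets (density (M i) (f i))"
    then have A [measurable]: "i \<in> I \<Longrightarrow> A i \<in> sets (M i)" for i by simp
    have [measurable]: "Pi\<^sub>E I A \<in> sets (Pi\<^sub>M I M)"
      using \<open>finite I\<close> A by (rule sets_PiM_I_finite)
    have indicator: "indicator (Pi\<^sub>E I A) x = (\<Prod>i\<in>I. indicator (A i) (x i) :: ennreal)"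
      if "x \<in> space (Pi\<^sub>M I M)" for x
    proof (cases "\<forall>i\<in>I. x i \<in> A i")
      case True
      then show ?thesis using that by (auto simp: space_PiM PiE_iff)
    next
      case False
      then show ?thesis using \<open>finite I\<close> by (auto simp: PiE_iff indicator_def intro!: prod_zero[symmetric])
    qed
    have "emeasure (density (Pi\<^sub>M I M) (\<lambda>x. \<Prod>i\<in>I. f i (x i))) (Pi\<^sub>E I A) =
        (\<integral>\<^sup>+x. (\<Prod>i\<in>I. f i (x i) * indicator (A i) (x i)) \<partial>Pi\<^sub>M I M)"
      using \<open>finite I\<close>
      by (subst emeasure_density)
        (auto intro!: nn_integral_cong simp: prod.distrib indicator)
    also have "\<dots> = (\<Prod>i\<in>I. emeasure (density (M i) (f i)) (A i))"
      using \<open>finite I\<close> by (subst product_nn_integral_prod) (auto simp: emeasure_density intro!: prod.cong)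
    finally show "emeasure (density (Pi\<^sub>M I M) (\<lambda>x. \<Prod>i\<in>I. f i (x i))) (Pi\<^sub>E I A) =
        (\<Prod>i\<in>I. emeasure (density (M i) (f i)) (A i))" .
  qed
qed

lemma normal_vec_eq_density:
  fixes m s :: "real ^ 'n"
  assumes s: "\<And>i. 0 < s $ i"
  shows "normal_vec m s = density lborel (\<lambda>y. ennreal (\<Prod>i\<in>UNIV. normal_density (m $ i) (s $ i) (y $ i)))"
proof -
  interpret product_sigma_finite "\<lambda>_::'n. lborel :: real measure" ..
  have [measurable]: "(\<lambda>y. y $ i) \<in> borel_measurable (borel :: (real ^ 'n) measure)" for i
    by (intro borel_measurable_continuous_onI continuous_intros)
  have [measurable]: "vec_lambda \<in> (\<Pi>\<^sub>M i\<in>UNIV. lborel) \<rightarrow>\<^sub>M (borel :: (real ^ 'n) measure)"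
    using measurable_vec_lambda by (simp cong: measurable_cong_sets sets_PiM_cong)
  have fin: "sigma_finite_measure (density lborel (\<lambda>x. ennreal (normal_density (m $ i) (s $ i) x)))" for i
  proof -
    interpret prob_space "density lborel (\<lambda>x. ennreal (normal_density (m $ i) (s $ i) x))"
      using s by (rule prob_space_normal_density)
    show ?thesis by unfold_locales
  qed
  have "(\<Pi>\<^sub>M i\<in>UNIV. density lborel (\<lambda>x. ennreal (normal_density (m $ i) (s $ i) x))) =
      density (\<Pi>\<^sub>M i\<in>UNIV. lborel) (\<lambda>x. \<Prod>i\<in>UNIV. ennreal (normal_density (m $ i) (s $ i) (x i)))"
    using fin by (intro PiM_density) auto
  then show ?thesis
    unfolding normal_vec_def distr_PiM_lborel_vec_lambda[symmetric]
    by (simp add: density_distr prod_ennreal)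
qed

lemma normal_vec_sets [simp, measurable_cong]: "sets (normal_vec m s) = sets borel"
  by (simp add: normal_vec_def)

lemma normal_vec_space [simp]: "space (normal_vec m s) = UNIV"
  by (simp add: normal_vec_def)

lemma measurable_vec_lambda_density [measurable]:
  "vec_lambda \<in> (\<Pi>\<^sub>M i\<in>UNIV. density lborel (f i)) \<rightarrow>\<^sub>M (borel :: (real ^ 'n) measure)"
  using measurable_vec_lambda by (simp cong: measurable_cong_sets sets_PiM_cong)

lemma prob_space_normal_vec:
  fixes m s :: "real ^ 'n"
  assumes s: "\<And>i. 0 < s $ i"
  shows "prob_space (normal_vec m s)"
proof -
  let ?N = "\<lambda>i. density lborel (\<lambda>x. ennreal (normal_density (m $ i) (s $ i) x))"
  interpret prob_space "?N i" for i
    using s by (rule prob_space_normal_density)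
  interpret product_prob_space ?N UNIV ..
  show ?thesis
    unfolding normal_vec_def by (rule prob_space_distr) measurable
qed

section \<open>First and second moments of normal vectors\<close>

text \<open>Each integrand is written as a product over all coordinates, with factor 1 at those not
  involved; independence then reduces everything to one-dimensional moments.\<close>

lemma normal_vec_moments:
  fixes m s :: "real ^ 'n" and i k :: 'n
  assumes s: "\<And>i. 0 < s $ i"
  shows "has_bochner_integral (normal_vec m s) (\<lambda>y. y $ i - m $ i) 0" (is ?first)
    and "has_bochner_integral (normal_vec m s) (\<lambda>y. (y $ i - m $ i) * (y $ k - m $ k))
      (if i = k then (s $ i)\<^sup>2 else 0)" (is ?second)
proof -
  let ?N = "\<lambda>j. density lborel (\<lambda>x. ennreal (normal_density (m $ j) (s $ j) x))"
  interpret prob_space "?N j" for j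
    using s by (rule prob_space_normal_density)
  interpret product_prob_space ?N UNIV ..
  have [measurable]: "(\<lambda>y. y $ j) \<in> borel_measurable (borel :: (real ^ 'n) measure)" for j
    by (intro borel_measurable_continuous_onI continuous_intros)
  \<comment> \<open>Index 0 of the odd moments is exponent 1, and index 1 of the even moments is
    exponent 2.\<close>
  have moment1: "has_bochner_integral (?N j) (\<lambda>x. x - m $ j) 0" for j
    using normal_moment_odd[OF s[of j], of "m $ j" 0] by (intro has_bochner_integral_density) auto
  have moment2: "has_bochner_integral (?N j) (\<lambda>x. (x - m $ j)\<^sup>2) ((s $ j)\<^sup>2)" for j
    using normal_moment_even[OF s[of j], of "m $ j" 1]
    by (intro has_bochner_integral_density) (auto simp: fact_numeral)
  have moment0: "has_bochner_integral (?N j) (\<lambda>x. 1 :: real) 1" for j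
    using s[of j] by (intro has_bochner_integral_density) (simp_all add: has_bochner_integral_iff)
  have product: "has_bochner_integral (normal_vec m s) (\<lambda>y. \<Prod>j\<in>UNIV. f j (y $ j)) (\<Prod>j\<in>UNIV. v j)"
    if f: "\<And>j. has_bochner_integral (?N j) (f j) (v j)" for f :: "'n \<Rightarrow> real \<Rightarrow> real" and v
  proof -
    have [measurable]: "f j \<in> borel_measurable borel" for j
      using borel_measurable_has_bochner_integral[OF f[of j]] by simp
    have f_int: "integrable (?N j) (f j)" "integral\<^sup>L (?N j) (f j) = v j" for j
      using f[of j] by (simp_all only: has_bochner_integral_iff)
    have "integrable (Pi\<^sub>M UNIV ?N) (\<lambda>x. \<Prod>j\<in>UNIV. f j (x j))"
      using f_int(1) by (intro product_integrable_prod) simp_all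
    moreover have "(\<integral>x. (\<Prod>j\<in>UNIV. f j (x j)) \<partial>Pi\<^sub>M UNIV ?N) = (\<Prod>j\<in>UNIV. v j)"
      using product_integral_prod[of UNIV f] f_int by simp
    ultimately have "has_bochner_integral (Pi\<^sub>M UNIV ?N) (\<lambda>x. \<Prod>j\<in>UNIV. f j (vec_lambda x $ j)) (\<Prod>j\<in>UNIV. v j)"
      by (simp add: has_bochner_integral_iff)
    then show ?thesis
      unfolding normal_vec_def
      by (rule has_bochner_integral_distr[OF _ measurable_vec_lambda_density, rotated]) measurable
  qed
  have "has_bochner_integral (?N j) (\<lambda>x. if j = i then x - m $ j else 1) (if j = i then 0 else 1)" for j
    using moment0[of j] moment1[of j] by (cases "j = i") simp_all
  from product[OF this] show ?first
    by (simp add: prod.delta)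
  show ?second
  proof (cases "i = k")
    case True
    have "has_bochner_integral (?N j) (\<lambda>x. if j = i then (x - m $ j)\<^sup>2 else 1) (if j = i then (s $ j)\<^sup>2 else 1)" for j
      using moment0[of j] moment2[of j] by (cases "j = i") simp_all
    from product[OF this] show ?thesis
      using True by (simp add: prod.delta power2_eq_square)
  next
    case False
    have "has_bochner_integral (?N j) (\<lambda>x. (if j = i then x - m $ j else 1) * (if j = k then x - m $ j else 1))
        (if j = i \<or> j = k then 0 else 1)" for j
      using moment0[of j] moment1[of j] False by (cases "j = i"; cases "j = k") simp_all
    note product[OF this]
    moreover have "(\<Prod>j\<in>UNIV. if j = i \<or> j = k then 0 else 1 :: real) = 0"
      by (rule prod_zero) auto
    ultimately show ?thesis
      using False by (simp add: prod.distrib prod.delta)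
  qed
qed

text \<open>Distinct coordinates are uncorrelated, so only the diagonal of \<open>A\<close>
  contributes.\<close>

lemma normal_vec_centered_quadratic:
  fixes m s :: "real ^ 'n" and A :: "real ^ 'n ^ 'n"
  assumes s: "\<And>i. 0 < s $ i"
  shows "has_bochner_integral (normal_vec m s) (\<lambda>y. (y - m) \<bullet> (A *v (y - m))) (\<Sum>i\<in>UNIV. A $ i $ i * (s $ i)\<^sup>2)"
proof -
  have "has_bochner_integral (normal_vec m s) (\<lambda>y. \<Sum>i\<in>UNIV. \<Sum>k\<in>UNIV. A $ i $ k * ((y $ i - m $ i) * (y $ k - m $ k)))
      (\<Sum>i\<in>UNIV. \<Sum>k\<in>UNIV. A $ i $ k * (if i = k then (s $ i)\<^sup>2 else 0))"
    by (intro has_bochner_integral_sum has_bochner_integral_mult_right normal_vec_moments s)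
  moreover have "(\<Sum>i\<in>UNIV. \<Sum>k\<in>UNIV. A $ i $ k * (if i = k then (s $ i)\<^sup>2 else 0)) = (\<Sum>i\<in>UNIV. A $ i $ i * (s $ i)\<^sup>2)"
    by (simp add: if_distrib cong: if_cong)
  moreover have "(\<Sum>i\<in>UNIV. \<Sum>k\<in>UNIV. A $ i $ k * ((y $ i - m $ i) * (y $ k - m $ k))) = (y - m) \<bullet> (A *v (y - m))" for y
    by (simp add: inner_vec_def matrix_vector_mult_def sum_distrib_left mult_ac)
  ultimately show ?thesis by simp
qed

text \<open>Expanding around the mean leaves a constant, a centered quadratic form and a linear term
  with expectation 0. The matrix is not assumed symmetric, hence the transpose in the linear
  term.\<close>

lemma normal_vec_quadratic:
  fixes m s :: "real ^ 'n" and A :: "real ^ 'n ^ 'n"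
  assumes s: "\<And>i. 0 < s $ i"
  shows "has_bochner_integral (normal_vec m s) (\<lambda>y. y \<bullet> (A *v y)) (m \<bullet> (A *v m) + (\<Sum>i\<in>UNIV. A $ i $ i * (s $ i)\<^sup>2))"
proof -
  interpret prob_space "normal_vec m s" by (rule prob_space_normal_vec[OF s])
  have linear: "has_bochner_integral (normal_vec m s) (\<lambda>y. (y - m) \<bullet> w) 0" for w
  proof -
    have "has_bochner_integral (normal_vec m s) (\<lambda>y. \<Sum>i\<in>UNIV. (y $ i - m $ i) * w $ i) (\<Sum>i\<in>UNIV. 0 * w $ i)"
      by (intro has_bochner_integral_sum has_bochner_integral_mult_left normal_vec_moments s)
    then show ?thesis by (simp add: inner_vec_def)
  qed
  have "has_bochner_integral (normal_vec m s) (\<lambda>y. m \<bullet> (A *v m)) (m \<bullet> (A *v m))"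
    using prob_space by (simp add: has_bochner_integral_iff)
  from has_bochner_integral_add[OF has_bochner_integral_add[OF this normal_vec_centered_quadratic[OF s, of m A]]
      linear[of "A *v m + transpose A *v m"]]
  have "has_bochner_integral (normal_vec m s)
      (\<lambda>y. m \<bullet> (A *v m) + (y - m) \<bullet> (A *v (y - m)) + (y - m) \<bullet> (A *v m + transpose A *v m))
      (m \<bullet> (A *v m) + (\<Sum>i\<in>UNIV. A $ i $ i * (s $ i)\<^sup>2))"
    by simp
  moreover have "m \<bullet> (A *v m) + (y - m) \<bullet> (A *v (y - m)) + (y - m) \<bullet> (A *v m + transpose A *v m) = y \<bullet> (A *v y)" for y
  proof -
    have "(y - m) \<bullet> (transpose A *v m) = m \<bullet> (A *v (y - m))"
      by (metis dot_lmul_matrix inner_commute transpose_matrix_vector)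
    then show ?thesis
      by (simp add: inner_add_right matrix_vector_mult_diff_distrib inner_diff_left inner_diff_right)
  qed
  ultimately show ?thesis by simp
qed

section \<open>Mutual information and conditional laws with densities\<close>

text \<open>
  Keeping the positive and negative parts of the log-density ratio apart, with the negative part
  bounded, covers finite and infinite mutual information at once.
\<close>

lemma mutual_info_density:
  fixes f :: "'u \<Rightarrow> 'v \<Rightarrow> real" and g :: "'v \<Rightarrow> real"
  assumes "prob_space M" and U [measurable]: "U \<in> M \<rightarrow>\<^sub>M S" and V [measurable]: "V \<in> M \<rightarrow>\<^sub>M T"
    and "sigma_finite_measure \<nu>" and \<nu> [measurable_cong]: "sets \<nu> = sets T"
    and f [measurable]: "(\<lambda>(u, v). f u v) \<in> borel_measurable (S \<Otimes>\<^sub>M T)"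
    and f_pos: "\<And>u v. u \<in> space S \<Longrightarrow> v \<in> space T \<Longrightarrow> 0 < f u v"
    and g [measurable]: "g \<in> borel_measurable T"
    and g_pos: "\<And>v. v \<in> space T \<Longrightarrow> 0 < g v"
    and g_eq: "\<And>v. v \<in> space T \<Longrightarrow> (\<integral>\<^sup>+u. ennreal (f u v) \<partial>distr M S U) = ennreal (g v)"
    and joint: "distr M (S \<Otimes>\<^sub>M T) (\<lambda>x. (U x, V x)) =
      density (distr M S U \<Otimes>\<^sub>M \<nu>) (\<lambda>(u, v). ennreal (f u v))"
  shows "0 \<le> mutual_info M S T U V"
    and "(\<integral>\<^sup>+x. ennreal (ln (f (U x) (V x) / g (V x))) \<partial>M) =
      e2ennreal (mutual_info M S T U V) + (\<integral>\<^sup>+x. ennreal (- ln (f (U x) (V x) / g (V x))) \<partial>M)"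
    and "(\<integral>\<^sup>+x. ennreal (- ln (f (U x) (V x) / g (V x))) \<partial>M) \<le> 1"
proof -
  interpret M: prob_space M by fact
  interpret \<nu>: sigma_finite_measure \<nu> by fact
  define \<mu> where "\<mu> = distr M S U"
  define N where "N = distr M T V"
  define J where "J = distr M (S \<Otimes>\<^sub>M T) (\<lambda>x. (U x, V x))"
  define Q where "Q = \<mu> \<Otimes>\<^sub>M N"
  define \<phi> where "\<phi> = (\<lambda>(u, v). ln (f u v / g v))"
  interpret \<mu>: prob_space \<mu> unfolding \<mu>_def by (rule M.prob_space_distr[OF U])
  interpret N: prob_space N unfolding N_def by (rule M.prob_space_distr[OF V])
  interpret J: prob_space J unfolding J_def by (rule M.prob_space_distr) measurable
  interpret \<mu>\<nu>: pair_sigma_finite \<mu> \<nu> ..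
  interpret Q: pair_prob_space \<mu> N ..
  have sets_\<mu> [measurable_cong, simp]: "sets \<mu> = sets S" by (simp add: \<mu>_def)
  have sets_N [measurable_cong, simp]: "sets N = sets T" by (simp add: N_def)
  have sets_J [measurable_cong, simp]: "sets J = sets (S \<Otimes>\<^sub>M T)" by (simp add: J_def)
  have sets_Q [measurable_cong, simp]: "sets Q = sets (S \<Otimes>\<^sub>M T)"
    unfolding Q_def by (rule sets_pair_measure_cong) simp_all
  have space_\<nu>: "space \<nu> = space T" using sets_eq_imp_space_eq[OF \<nu>] .
  have space_\<mu>: "space \<mu> = space S" by (simp add: \<mu>_def)
  have space_Q: "space Q = space S \<times> space T"
    using sets_eq_imp_space_eq[OF sets_Q] by (simp add: space_pair_measure)
  have space_J: "space J = space S \<times> space T"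
    using sets_eq_imp_space_eq[OF sets_J] by (simp add: space_pair_measure)
  have [measurable]: "\<phi> \<in> borel_measurable (S \<Otimes>\<^sub>M T)"
    unfolding \<phi>_def by measurable
  have J_eq: "J = density (\<mu> \<Otimes>\<^sub>M \<nu>) (\<lambda>(u, v). ennreal (f u v))"
    by (simp add: J_def joint \<mu>_def)
  \<comment> \<open>Integrating \<open>u\<close> out of the joint density shows that the mixture
    \<open>g\<close> is the density of \<open>V\<close>.\<close>
  have N_eq: "N = density \<nu> (\<lambda>v. ennreal (g v))"
  proof (rule measure_eqI)
    fix B assume "B \<in> sets N"
    then have B [measurable]: "B \<in> sets T" by simp
    have "emeasure N B = emeasure J (space S \<times> B)"
      using sets.sets_into_space[OF B] measurable_space[OF U] measurable_space[OF V]
      by (auto simp: N_def J_def emeasure_distr intro!: arg_cong[where f = "emeasure M"])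
    also have "\<dots> = (\<integral>\<^sup>+p. (case p of (u, v) \<Rightarrow> ennreal (f u v)) * indicator (space S \<times> B) p \<partial>(\<mu> \<Otimes>\<^sub>M \<nu>))"
      unfolding J_eq by (rule emeasure_density) measurable
    also have "\<dots> = (\<integral>\<^sup>+v. \<integral>\<^sup>+u. ennreal (f u v) * indicator B v \<partial>\<mu> \<partial>\<nu>)"
      by (subst \<mu>\<nu>.nn_integral_snd[symmetric])
        (auto intro!: nn_integral_cong simp: space_\<mu> indicator_def)
    also have "\<dots> = (\<integral>\<^sup>+v. ennreal (g v) * indicator B v \<partial>\<nu>)"
      using g_eq by (intro nn_integral_cong) (simp add: nn_integral_multc space_\<nu> \<mu>_def)
    also have "\<dots> = emeasure (density \<nu> (\<lambda>v. ennreal (g v))) B"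
      by (rule emeasure_density[symmetric]) measurable
    finally show "emeasure N B = emeasure (density \<nu> (\<lambda>v. ennreal (g v))) B" .
  qed (simp add: \<nu>)
  have Q_eq: "Q = density (\<mu> \<Otimes>\<^sub>M \<nu>) (\<lambda>(u, v). ennreal (g v))"
  proof -
    have "density \<mu> (\<lambda>_. 1) \<Otimes>\<^sub>M density \<nu> (\<lambda>v. ennreal (g v)) = density (\<mu> \<Otimes>\<^sub>M \<nu>) (\<lambda>(u, v). 1 * ennreal (g v))"
      using N.sigma_finite_measure_axioms unfolding N_eq
      by (intro pair_measure_density) (auto intro: \<nu>.sigma_finite_measure_axioms)
    then show ?thesis by (simp add: Q_def N_eq density_1)
  qed
  have cancel: "ennreal (g v) * ennreal (f u v / g v) = ennreal (f u v)" if "u \<in> space S" "v \<in> space T" for u v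
    using that f_pos[of u v] g_pos[of v] by (simp add: ennreal_mult[symmetric])
  \<comment> \<open>Both \<open>J\<close> and \<open>Q\<close> have densities against the same
    product measure, so the likelihood ratio is the quotient f/g.\<close>
  have J_Q: "density Q (\<lambda>(u, v). ennreal (f u v / g v)) = J"
    unfolding Q_eq J_eq
    by (subst density_density_eq)
      (auto intro!: density_cong AE_I2 simp: space_pair_measure space_\<mu> space_\<nu> cancel)
  have ac: "absolutely_continuous Q J"
    unfolding J_Q[symmetric] by (rule absolutely_continuousI_density) measurable
  have "AE p in Q. (case p of (u, v) \<Rightarrow> ennreal (f u v / g v)) = RN_deriv Q J p"
    unfolding Q_def by (rule Q.RN_deriv_unique) (auto simp: J_Q Q_def[symmetric])
  then have "AE p in Q. entropy_density (exp 1) Q J p = \<phi> p"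
  proof (rule AE_mp, intro AE_I2 impI)
    fix p assume p: "p \<in> space Q" and eq: "(case p of (u, v) \<Rightarrow> ennreal (f u v / g v)) = RN_deriv Q J p"
    obtain u v where [simp]: "p = (u, v)" by (cases p)
    have "0 < f u v" "0 < g v" using p f_pos g_pos by (auto simp: space_Q)
    then show "entropy_density (exp 1) Q J p = \<phi> p"
      using eq[symmetric] by (simp add: entropy_density_def \<phi>_def log_def)
  qed
  \<comment> \<open>The Radon-Nikodym derivative is determined up to \<open>Q\<close>-null sets, and
    these are \<open>J\<close>-null by absolute continuity.\<close>
  then have AE_eq: "AE p in J. entropy_density (exp 1) Q J p = \<phi> p"
    using ac by (intro absolutely_continuous_AE[of J Q]) auto
  have mi: "mutual_info M S T U V = (if integrable J \<phi> then ereal (\<integral>p. \<phi> p \<partial>J) else \<infinity>)"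
  proof -
    have "integrable J (entropy_density (exp 1) Q J) \<longleftrightarrow> integrable J \<phi>"
      using AE_eq by (intro integrable_cong_AE) auto
    moreover have "KL_divergence (exp 1) Q J = (\<integral>p. \<phi> p \<partial>J)"
      unfolding KL_divergence_def using AE_eq by (intro integral_cong_AE) auto
    ultimately show ?thesis
      using ac by (simp add: mutual_info_def KL_def J_def[symmetric] Q_def[symmetric] \<mu>_def[symmetric] N_def[symmetric])
  qed
  \<comment> \<open>The inverse likelihood ratio: its integral under \<open>J\<close> is the total
    mass of \<open>Q\<close>. It dominates the negative part of \<open>\<phi>\<close> and also
    yields nonnegativity of the divergence.\<close>
  define ratio where "ratio = (\<lambda>(u, v). ennreal (g v / f u v))"
  have [measurable]: "ratio \<in> borel_measurable (S \<Otimes>\<^sub>M T)"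
    unfolding ratio_def by measurable
  have ratio: "(\<integral>\<^sup>+p. ratio p \<partial>J) = 1"
  proof -
    have "(\<integral>\<^sup>+p. ratio p \<partial>J) = (\<integral>\<^sup>+p. (case p of (u, v) \<Rightarrow> ennreal (f u v / g v)) * ratio p \<partial>Q)"
      unfolding J_Q[symmetric] by (rule nn_integral_density) measurable
    also have "\<dots> = (\<integral>\<^sup>+p. 1 \<partial>Q)"
      using f_pos g_pos
      by (intro nn_integral_cong)
        (auto simp: space_Q ratio_def ennreal_mult''[symmetric] less_imp_le less_imp_neq[symmetric])
    also have "\<dots> = 1" using Q.emeasure_space_1 by (simp add: Q_def)
    finally show ?thesis .
  qed
  \<comment> \<open>The inequality -ln t \<le> 1/t - 1 with the parts of the logarithm arranged so
    that both sides are nonnegative; integrating it gives Gibbs' inequality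
    \<open>An \<le> Ap\<close>.\<close>
  have le: "ennreal (- \<phi> p) + 1 \<le> ennreal (\<phi> p) + ratio p" if "p \<in> space J" for p
  proof -
    obtain u v where [simp]: "p = (u, v)" by (cases p)
    have pos: "0 < f u v" "0 < g v" using that f_pos g_pos by (auto simp: space_J)
    have "- \<phi> p = ln (g v / f u v)"
      using pos by (simp add: \<phi>_def ln_div)
    then have "- \<phi> p \<le> g v / f u v - 1"
      using pos ln_le_minus_one[of "g v / f u v"] by simp
    then show ?thesis
      using pos
      by (cases "0 \<le> \<phi> p")
        (auto simp: ratio_def ennreal_neg ennreal_1[symmetric] ennreal_plus[symmetric] simp del: ennreal_1 ennreal_plus)
  qed
  define Ap An where "Ap = (\<integral>\<^sup>+p. ennreal (\<phi> p) \<partial>J)" and "An = (\<integral>\<^sup>+p. ennreal (- \<phi> p) \<partial>J)"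
  have "(\<integral>\<^sup>+p. ennreal (- \<phi> p) + 1 \<partial>J) \<le> (\<integral>\<^sup>+p. ennreal (\<phi> p) + ratio p \<partial>J)"
    using le by (rule nn_integral_mono)
  then have "An + 1 \<le> Ap + 1"
    by (simp add: nn_integral_add ratio J.emeasure_space_1 An_def Ap_def)
  then have An_le: "An \<le> Ap"
    by (simp add: ennreal_add_left_cancel_le add.commute[of _ 1])
  have "(\<integral>\<^sup>+p. ennreal (- \<phi> p) \<partial>J) \<le> (\<integral>\<^sup>+p. ratio p \<partial>J)"
  proof (rule nn_integral_mono)
    fix p assume p: "p \<in> space J"
    obtain u v where [simp]: "p = (u, v)" by (cases p)
    have pos: "0 < f u v" "0 < g v" using p f_pos g_pos by (auto simp: space_J)
    have "- \<phi> p = ln (g v / f u v)"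
      using pos by (simp add: \<phi>_def ln_div)
    also have "\<dots> \<le> g v / f u v"
      using pos ln_le_minus_one[of "g v / f u v"] by simp
    finally show "ennreal (- \<phi> p) \<le> ratio p"
      by (simp add: ratio_def ennreal_leI)
  qed
  then have An_1: "An \<le> 1" by (simp add: ratio An_def)
  then have An_fin: "An \<noteq> \<infinity>" by (auto simp: top_unique)
  have nonneg: "0 \<le> mutual_info M S T U V" and split: "Ap = e2ennreal (mutual_info M S T U V) + An"
  proof -
    have "0 \<le> mutual_info M S T U V \<and> Ap = e2ennreal (mutual_info M S T U V) + An"
    proof (cases "integrable J \<phi>")
      case True
      then have int: "(\<integral>p. \<phi> p \<partial>J) = enn2real Ap - enn2real An" and Ap: "Ap \<noteq> \<infinity>"
        by (simp_all add: real_lebesgue_integral_def real_integrable_def Ap_def An_def)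
      obtain a where a: "0 \<le> a" "Ap = ennreal a" using Ap by (cases Ap) auto
      obtain b where b: "0 \<le> b" "An = ennreal b" using An_fin by (cases An) auto
      have "b \<le> a" using An_le a b by simp
      then show ?thesis
        using True a b by (simp add: mi int e2ennreal_ereal ennreal_plus[symmetric] del: ennreal_plus)
    next
      case False
      \<comment> \<open>As \<open>An\<close> is finite, integrability can fail only through the
        positive part, which agrees with the value infinity assigned by \<open>KL\<close>.\<close>
      then have "Ap = \<infinity>" using An_fin by (simp add: real_integrable_def Ap_def An_def)
      with False show ?thesis by (simp add: mi e2ennreal_infty)
    qed
    then show "0 \<le> mutual_info M S T U V" and "Ap = e2ennreal (mutual_info M S T U V) + An" by auto
  qed
  have Ap: "Ap = (\<integral>\<^sup>+x. ennreal (ln (f (U x) (V x) / g (V x))) \<partial>M)"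
    unfolding Ap_def J_def by (subst nn_integral_distr) (auto simp: \<phi>_def)
  have An: "An = (\<integral>\<^sup>+x. ennreal (- ln (f (U x) (V x) / g (V x))) \<partial>M)"
    unfolding An_def J_def by (subst nn_integral_distr) (auto simp: \<phi>_def)
  show "0 \<le> mutual_info M S T U V" by fact
  show "(\<integral>\<^sup>+x. ennreal (ln (f (U x) (V x) / g (V x))) \<partial>M) =
      e2ennreal (mutual_info M S T U V) + (\<integral>\<^sup>+x. ennreal (- ln (f (U x) (V x) / g (V x))) \<partial>M)"
    using split unfolding Ap An .
  show "(\<integral>\<^sup>+x. ennreal (- ln (f (U x) (V x) / g (V x))) \<partial>M) \<le> 1"
    using An_1 unfolding An .
qed

section \<open>Regular conditional distributions as kernels\<close>

text \<open>The defining equation on rectangles says that the joint law of (V, W) agrees with the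
  law of V followed by the kernel on an intersection-stable generator. The two measures therefore
  coincide, and arbitrary nonnegative integrands follow.\<close>

lemma cond_law_nn_integral:
  assumes "cond_law M S T V W K" and "prob_space M"
    and V [measurable]: "V \<in> M \<rightarrow>\<^sub>M S" and W [measurable]: "W \<in> M \<rightarrow>\<^sub>M T"
    and F [measurable]: "F \<in> borel_measurable (S \<Otimes>\<^sub>M T)"
  shows "(\<integral>\<^sup>+x. F (V x, W x) \<partial>M) = (\<integral>\<^sup>+v. \<integral>\<^sup>+w. F (v, w) \<partial>K v \<partial>distr M S V)"
proof -
  interpret M: prob_space M by fact
  have K [measurable]: "K \<in> S \<rightarrow>\<^sub>M prob_algebra T"
    and rect: "\<And>A B. A \<in> sets S \<Longrightarrow> B \<in> sets T \<Longrightarrow>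
      emeasure M {x \<in> space M. V x \<in> A \<and> W x \<in> B} = (\<integral>\<^sup>+v\<in>A. emeasure (K v) B \<partial>distr M S V)"
    using assms(1) by (auto simp: cond_law_def)
  define \<mu> where "\<mu> = distr M S V"
  define kernel where "kernel = (\<lambda>v. distr (K v) (S \<Otimes>\<^sub>M T) (\<lambda>w. (v, w)))"
  have [measurable_cong]: "sets \<mu> = sets S" by (simp add: \<mu>_def)
  have kernel: "kernel \<in> \<mu> \<rightarrow>\<^sub>M prob_algebra (S \<Otimes>\<^sub>M T)"
    unfolding kernel_def by measurable
  interpret \<mu>: prob_space \<mu> unfolding \<mu>_def by (rule M.prob_space_distr[OF V])
  have K_sets: "sets (K v) = sets T" if "v \<in> space S" for v
    using measurable_space[OF K that] by (simp add: space_prob_algebra)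
  have bind_sets: "sets (\<mu> \<bind> kernel) = sets (S \<Otimes>\<^sub>M T)"
    using \<mu>.not_empty by (intro sets_bind) (auto simp: kernel_def)
  have "distr M (S \<Otimes>\<^sub>M T) (\<lambda>x. (V x, W x)) = \<mu> \<bind> kernel"
  proof (rule measure_eqI_generator_eq)
    show "Int_stable {a \<times> b |a b. a \<in> sets S \<and> b \<in> sets T}"
      by (rule Int_stable_pair_measure_generator)
    show "{a \<times> b |a b. a \<in> sets S \<and> b \<in> sets T} \<subseteq> Pow (space S \<times> space T)"
      by (rule pair_measure_closed)
    show "sets (distr M (S \<Otimes>\<^sub>M T) (\<lambda>x. (V x, W x))) =
        sigma_sets (space S \<times> space T) {a \<times> b |a b. a \<in> sets S \<and> b \<in> sets T}"
      by (simp add: sets_pair_measure)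
    show "sets (\<mu> \<bind> kernel) = sigma_sets (space S \<times> space T) {a \<times> b |a b. a \<in> sets S \<and> b \<in> sets T}"
      by (simp add: bind_sets sets_pair_measure)
    show "range (\<lambda>_::nat. space S \<times> space T) \<subseteq> {a \<times> b |a b. a \<in> sets S \<and> b \<in> sets T}"
      by auto
    show "emeasure (distr M (S \<Otimes>\<^sub>M T) (\<lambda>x. (V x, W x))) (space S \<times> space T) \<noteq> \<infinity>"
      by (simp add: emeasure_distr)
    fix X assume "X \<in> {a \<times> b |a b. a \<in> sets S \<and> b \<in> sets T}"
    then obtain A B where X: "X = A \<times> B" and [measurable]: "A \<in> sets S" "B \<in> sets T" by auto
    have "emeasure (distr M (S \<Otimes>\<^sub>M T) (\<lambda>x. (V x, W x))) X = emeasure M {x \<in> space M. V x \<in> A \<and> W x \<in> B}"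
      by (auto simp: X emeasure_distr intro!: arg_cong[where f = "emeasure M"])
    also have "\<dots> = (\<integral>\<^sup>+v\<in>A. emeasure (K v) B \<partial>\<mu>)"
      by (simp add: rect \<mu>_def)
    also have "\<dots> = (\<integral>\<^sup>+v. emeasure (kernel v) X \<partial>\<mu>)"
    proof (rule nn_integral_cong)
      fix v assume "v \<in> space \<mu>"
      then have v: "v \<in> space S" by (simp add: \<mu>_def)
      have "(\<lambda>w. (v, w)) -` (A \<times> B) \<inter> space (K v) = (if v \<in> A then B else {})"
        using sets.sets_into_space[OF \<open>B \<in> sets T\<close>] sets_eq_imp_space_eq[OF K_sets[OF v]] by auto
      then show "emeasure (K v) B * indicator A v = emeasure (kernel v) X"
        using v K_sets[OF v] unfolding kernel_def X
        by (subst emeasure_distr) (auto cong: measurable_cong_sets)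
    qed
    also have "\<dots> = emeasure (\<mu> \<bind> kernel) X"
      using \<mu>.not_empty measurable_prob_algebraD[OF kernel] by (subst emeasure_bind) (auto simp: X)
    finally show "emeasure (distr M (S \<Otimes>\<^sub>M T) (\<lambda>x. (V x, W x))) X = emeasure (\<mu> \<bind> kernel) X" .
  qed auto
  moreover have "(\<integral>\<^sup>+x. F (V x, W x) \<partial>M) = (\<integral>\<^sup>+p. F p \<partial>distr M (S \<Otimes>\<^sub>M T) (\<lambda>x. (V x, W x)))"
    by (rule nn_integral_distr[symmetric]) measurable
  ultimately have "(\<integral>\<^sup>+x. F (V x, W x) \<partial>M) = (\<integral>\<^sup>+p. F p \<partial>(\<mu> \<bind> kernel))"
    by simp
  also have "\<dots> = (\<integral>\<^sup>+v. \<integral>\<^sup>+p. F p \<partial>kernel v \<partial>\<mu>)"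
    by (rule nn_integral_bind[OF F measurable_prob_algebraD[OF kernel]])
  also have "\<dots> = (\<integral>\<^sup>+v. \<integral>\<^sup>+w. F (v, w) \<partial>K v \<partial>\<mu>)"
  proof (rule nn_integral_cong)
    fix v assume "v \<in> space \<mu>"
    then have v: "v \<in> space S" by (simp add: \<mu>_def)
    then show "(\<integral>\<^sup>+p. F p \<partial>kernel v) = (\<integral>\<^sup>+w. F (v, w) \<partial>K v)"
      using K_sets[OF v] unfolding kernel_def
      by (subst nn_integral_distr) (auto cong: measurable_cong_sets)
  qed
  finally show ?thesis by (simp add: \<mu>_def)
qed

text \<open>Two successive disintegrations: V is integrated out given (L, U), then U given L. The
  test set \<open>B\<close> need not be a rectangle, which is why the integral form of
  \<open>cond_law\<close> is used. For the model, the composed kernel is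
  \<open>joint_given\<close>.\<close>

lemma cond_law_pair:
  fixes L :: "'o \<Rightarrow> 'c" and U :: "'o \<Rightarrow> 'a" and V :: "'o \<Rightarrow> 'b"
  assumes 1: "cond_law M R S L U P"
    and 2: "cond_law M (R \<Otimes>\<^sub>M S) T (\<lambda>x. (L x, U x)) V (\<lambda>(l, u). F l u)"
    and "prob_space M"
    and L [measurable]: "L \<in> M \<rightarrow>\<^sub>M R" and U [measurable]: "U \<in> M \<rightarrow>\<^sub>M S" and V [measurable]: "V \<in> M \<rightarrow>\<^sub>M T"
  shows "cond_law M R (S \<Otimes>\<^sub>M T) L (\<lambda>x. (U x, V x)) (\<lambda>l. P l \<bind> (\<lambda>u. distr (F l u) (S \<Otimes>\<^sub>M T) (\<lambda>v. (u, v))))"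
  unfolding cond_law_def
proof (intro conjI ballI)
  have P [measurable]: "P \<in> R \<rightarrow>\<^sub>M prob_algebra S"
    and F [measurable]: "(\<lambda>(l, u). F l u) \<in> R \<Otimes>\<^sub>M S \<rightarrow>\<^sub>M prob_algebra T"
    using 1 2 by (auto simp: cond_law_def)
  show "(\<lambda>l. P l \<bind> (\<lambda>u. distr (F l u) (S \<Otimes>\<^sub>M T) (\<lambda>v. (u, v)))) \<in> R \<rightarrow>\<^sub>M prob_algebra (S \<Otimes>\<^sub>M T)"
    by measurable
  fix A B assume A [measurable]: "A \<in> sets R" and B [measurable]: "B \<in> sets (S \<Otimes>\<^sub>M T)"
  have P_sets: "sets (P l) = sets S" if "l \<in> space R" for l
    using measurable_space[OF P that] by (simp add: space_prob_algebra)
  \<comment> \<open>\<open>G\<close> is the indicator of the event, and \<open>H\<close> its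
    conditional probability once L and U are known.\<close>
  define G :: "('c \<times> 'a) \<times> 'b \<Rightarrow> ennreal" where "G = (\<lambda>((l, u), v). indicator A l * indicator B (u, v))"
  define H where "H = (\<lambda>p. \<integral>\<^sup>+v. G (p, v) \<partial>(case p of (l, u) \<Rightarrow> F l u))"
  have [measurable]: "G \<in> borel_measurable ((R \<Otimes>\<^sub>M S) \<Otimes>\<^sub>M T)"
    unfolding G_def case_prod_beta by measurable
  have [measurable]: "H \<in> borel_measurable (R \<Otimes>\<^sub>M S)"
    unfolding H_def
    by (rule nn_integral_measurable_subprob_algebra2[OF _ measurable_prob_algebraD[OF F]]) measurable
  have "emeasure M {x \<in> space M. L x \<in> A \<and> (U x, V x) \<in> B} =
      (\<integral>\<^sup>+x. indicator {x \<in> space M. L x \<in> A \<and> (U x, V x) \<in> B} x \<partial>M)"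
    by (rule nn_integral_indicator[symmetric]) measurable
  also have "\<dots> = (\<integral>\<^sup>+x. G ((L x, U x), V x) \<partial>M)"
    by (rule nn_integral_cong) (auto simp: G_def indicator_def)
  also have "\<dots> = (\<integral>\<^sup>+p. H p \<partial>distr M (R \<Otimes>\<^sub>M S) (\<lambda>x. (L x, U x)))"
    unfolding H_def by (rule cond_law_nn_integral[OF 2 \<open>prob_space M\<close>]) measurable
  also have "\<dots> = (\<integral>\<^sup>+x. H (L x, U x) \<partial>M)"
    by (rule nn_integral_distr) measurable
  also have "\<dots> = (\<integral>\<^sup>+l. \<integral>\<^sup>+u. H (l, u) \<partial>P l \<partial>distr M R L)"
    by (rule cond_law_nn_integral[OF 1 \<open>prob_space M\<close> L U]) measurable
  also have "\<dots> = (\<integral>\<^sup>+l\<in>A. emeasure (P l \<bind> (\<lambda>u. distr (F l u) (S \<Otimes>\<^sub>M T) (\<lambda>v. (u, v)))) B \<partial>distr M R L)"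
  proof (rule nn_integral_cong)
    fix l assume "l \<in> space (distr M R L)"
    then have l: "l \<in> space R" by simp
    have Pl: "P l \<in> space (prob_algebra S)" by (rule measurable_space[OF P l])
    have Fl [measurable]: "F l \<in> S \<rightarrow>\<^sub>M prob_algebra T"
      using measurable_Pair2[OF F l] by simp
    have F_sets: "sets (F l u) = sets T" if "u \<in> space S" for u
      using measurable_space[OF Fl that] by (simp add: space_prob_algebra)
    have "emeasure (P l \<bind> (\<lambda>u. distr (F l u) (S \<Otimes>\<^sub>M T) (\<lambda>v. (u, v)))) B =
        (\<integral>\<^sup>+u. emeasure (distr (F l u) (S \<Otimes>\<^sub>M T) (\<lambda>v. (u, v))) B \<partial>P l)"
      by (rule emeasure_bind_prob_algebra[OF Pl _ B]) measurable
    also have "\<dots> = (\<integral>\<^sup>+u. \<integral>\<^sup>+v. indicator B (u, v) \<partial>F l u \<partial>P l)"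
    proof (rule nn_integral_cong)
      fix u assume "u \<in> space (P l)"
      then have u: "u \<in> space S" using sets_eq_imp_space_eq[OF P_sets[OF l]] by simp
      show "emeasure (distr (F l u) (S \<Otimes>\<^sub>M T) (\<lambda>v. (u, v))) B = (\<integral>\<^sup>+v. indicator B (u, v) \<partial>F l u)"
        using u F_sets[OF u] B
        by (subst nn_integral_indicator[symmetric], simp, subst nn_integral_distr)
          (auto cong: measurable_cong_sets)
    qed
    finally show "(\<integral>\<^sup>+u. H (l, u) \<partial>P l) =
        emeasure (P l \<bind> (\<lambda>u. distr (F l u) (S \<Otimes>\<^sub>M T) (\<lambda>v. (u, v)))) B * indicator A l"
      by (simp add: H_def G_def indicator_def)
  qed
  finally show "emeasure M {x \<in> space M. L x \<in> A \<and> (U x, V x) \<in> B} =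
      (\<integral>\<^sup>+l\<in>A. emeasure (P l \<bind> (\<lambda>u. distr (F l u) (S \<Otimes>\<^sub>M T) (\<lambda>v. (u, v)))) B \<partial>distr M R L)" .
qed

text \<open>For a fixed event, the two conditional probabilities have equal integrals over every
  measurable set and so agree almost everywhere, but the null set depends on the event. A countable
  generator allows one null set for all events.\<close>

lemma cond_law_unique:
  fixes W :: "'o \<Rightarrow> 'w :: second_countable_topology"
  assumes 1: "cond_law M R borel V W K" and 2: "cond_law M R borel V W K'"
    and "prob_space M" and V: "V \<in> M \<rightarrow>\<^sub>M R"
  shows "AE v in distr M R V. K v = K' v"
proof -
  interpret M: prob_space M by fact
  interpret D: prob_space "distr M R V" by (rule M.prob_space_distr[OF V])
  obtain B :: "'w set set" where B: "countable B" "topological_basis B"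
    using ex_countable_basis by auto
  \<comment> \<open>Finite intersections of basic open sets form a countable generator that is stable under intersection.\<close>
  define G where "G = Inter ` {F. finite F \<and> F \<subseteq> B}"
  have G_countable: "countable G"
    unfolding G_def using B(1) by (intro countable_image countable_Collect_finite_subset)
  have "open X" if "X \<in> G" for X
    using that topological_basis_open[OF B(2)] by (auto simp: G_def intro!: open_Inter)
  moreover have "B \<subseteq> G"
    by (auto simp: G_def intro!: image_eqI[where x = "{_}"])
  ultimately have "topological_basis G"
    using B(2) unfolding topological_basis_def by (meson subset_trans)
  then have G_borel: "borel = sigma UNIV G"
    by (rule borel_eq_countable_basis[OF G_countable])
  have G_Int: "Int_stable G"
    unfolding Int_stable_def G_def by (auto simp: Inter_Un_distrib[symmetric] intro!: imageI)
  have G_UNIV: "UNIV \<in> G"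
    by (auto simp: G_def intro!: image_eqI[where x = "{}"])
  have K: "K \<in> R \<rightarrow>\<^sub>M prob_algebra borel" and K': "K' \<in> R \<rightarrow>\<^sub>M prob_algebra borel"
    using 1 2 by (auto simp: cond_law_def)
  note [measurable] = measurable_prob_algebraD[OF K] measurable_prob_algebraD[OF K']
  have "AE v in distr M R V. emeasure (K v) X = emeasure (K' v) X" if "X \<in> G" for X
  proof (rule D.density_unique_finite_measure)
    have [measurable]: "X \<in> sets borel"
      using that by (simp add: G_borel)
    show "(\<lambda>v. emeasure (K v) X) \<in> borel_measurable (distr M R V)"
      "(\<lambda>v. emeasure (K' v) X) \<in> borel_measurable (distr M R V)" by measurable
    show "(\<integral>\<^sup>+v\<in>A. emeasure (K v) X \<partial>distr M R V) = (\<integral>\<^sup>+v\<in>A. emeasure (K' v) X \<partial>distr M R V)"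
      if "A \<in> sets (distr M R V)" for A
    proof -
      have "(\<integral>\<^sup>+v\<in>A. emeasure (k v) X \<partial>distr M R V) = emeasure M {x \<in> space M. V x \<in> A \<and> W x \<in> X}"
        if "cond_law M R borel V W k" for k
        using that \<open>A \<in> sets (distr M R V)\<close> \<open>X \<in> sets borel\<close> by (simp add: cond_law_def)
      with 1 2 show ?thesis by simp
    qed
  qed auto
  then have "AE v in distr M R V. \<forall>X\<in>G. emeasure (K v) X = emeasure (K' v) X"
    by (simp add: AE_ball_countable[OF G_countable])
  then show ?thesis
  proof (rule AE_mp, intro AE_I2 impI)
    fix v assume "v \<in> space (distr M R V)" and eq: "\<forall>X\<in>G. emeasure (K v) X = emeasure (K' v) X"
    then have v: "v \<in> space R" by simp
    have sets: "sets (K v) = sets borel" "sets (K' v) = sets borel" and "prob_space (K v)"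
      using measurable_space[OF K v] measurable_space[OF K' v] by (auto simp: space_prob_algebra)
    then interpret Kv: prob_space "K v" by simp
    show "K v = K' v"
    proof (rule measure_eqI_generator_eq[where E = G and \<Omega> = UNIV and A = "\<lambda>_. UNIV"])
      show "sets (K v) = sigma_sets UNIV G" "sets (K' v) = sigma_sets UNIV G"
        using sets arg_cong[OF G_borel, of sets] by auto
    qed (use G_Int G_UNIV eq in auto)
  qed
qed

section \<open>Kernels with densities and the Markov property\<close>

text \<open>Turns the sequential description of a joint law, as in \<open>joint_given\<close>, into
  a density against P times the reference measure, the form required by
  \<open>mutual_info_density\<close>.\<close>

lemma bind_distr_density:
  fixes f :: "'b \<Rightarrow> 'c \<Rightarrow> real"
  assumes P: "P \<in> space (prob_algebra S)" and "sigma_finite_measure \<nu>" and \<nu> [measurable_cong]: "sets \<nu> = sets T"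
    and f [measurable]: "(\<lambda>(b, y). f b y) \<in> borel_measurable (S \<Otimes>\<^sub>M T)"
    and kernel [measurable]: "(\<lambda>b. density \<nu> (\<lambda>y. ennreal (f b y))) \<in> S \<rightarrow>\<^sub>M prob_algebra T"
  shows "P \<bind> (\<lambda>b. distr (density \<nu> (\<lambda>y. ennreal (f b y))) (S \<Otimes>\<^sub>M T) (\<lambda>y. (b, y))) =
    density (P \<Otimes>\<^sub>M \<nu>) (\<lambda>(b, y). ennreal (f b y))" (is "?bind = ?density")
proof (rule measure_eqI)
  interpret P: prob_space P using P by (simp add: space_prob_algebra)
  interpret \<nu>: sigma_finite_measure \<nu> by fact
  interpret pair_sigma_finite P \<nu> ..
  have [measurable_cong]: "sets P = sets S" using P by (simp add: space_prob_algebra)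
  have kernel': "(\<lambda>b. distr (density \<nu> (\<lambda>y. ennreal (f b y))) (S \<Otimes>\<^sub>M T) (\<lambda>y. (b, y))) \<in> S \<rightarrow>\<^sub>M prob_algebra (S \<Otimes>\<^sub>M T)"
    by measurable
  have sets_bind: "sets ?bind = sets (S \<Otimes>\<^sub>M T)"
    by (rule sets_bind'[OF P kernel'])
  have sets_pair: "sets (P \<Otimes>\<^sub>M \<nu>) = sets (S \<Otimes>\<^sub>M T)"
    by (rule sets_pair_measure_cong) (use P \<nu> in \<open>auto simp: space_prob_algebra\<close>)
  show "sets ?bind = sets ?density"
    by (simp add: sets_bind sets_pair)
  fix A assume "A \<in> sets ?bind"
  then have A [measurable]: "A \<in> sets (S \<Otimes>\<^sub>M T)" by (simp add: sets_bind)
  have "emeasure ?bind A =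
      (\<integral>\<^sup>+b. emeasure (distr (density \<nu> (\<lambda>y. ennreal (f b y))) (S \<Otimes>\<^sub>M T) (\<lambda>y. (b, y))) A \<partial>P)"
    by (rule emeasure_bind_prob_algebra[OF P kernel' A])
  also have "\<dots> = (\<integral>\<^sup>+b. \<integral>\<^sup>+y. ennreal (f b y) * indicator A (b, y) \<partial>\<nu> \<partial>P)"
  proof (rule nn_integral_cong)
    fix b assume "b \<in> space P"
    then have b [measurable]: "b \<in> space S" using P sets_eq_imp_space_eq by (auto simp: space_prob_algebra)
    have "(\<lambda>y. (b, y)) -` A \<inter> space T \<in> sets T" by (rule measurable_sets[OF _ A]) measurable
    then have "(\<lambda>y. (b, y)) -` A \<inter> space \<nu> \<in> sets \<nu>" using \<nu> sets_eq_imp_space_eq[OF \<nu>] by simp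
    moreover have "(\<lambda>y. ennreal (f b y)) \<in> borel_measurable \<nu>" by measurable
    ultimately show "emeasure (distr (density \<nu> (\<lambda>y. ennreal (f b y))) (S \<Otimes>\<^sub>M T) (\<lambda>y. (b, y))) A =
        (\<integral>\<^sup>+y. ennreal (f b y) * indicator A (b, y) \<partial>\<nu>)"
      by (subst emeasure_distr)
        (auto simp: emeasure_density indicator_def intro!: nn_integral_cong)
  qed
  also have "\<dots> = (\<integral>\<^sup>+p. (case p of (b, y) \<Rightarrow> ennreal (f b y)) * indicator A p \<partial>(P \<Otimes>\<^sub>M \<nu>))"
    by (subst \<nu>.nn_integral_fst[symmetric]) auto
  also have "\<dots> = emeasure ?density A"
    by (rule emeasure_density[symmetric]) measurable
  finally show "emeasure ?bind A = emeasure ?density A" .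
qed

text \<open>The Markov property at work: a kernel that does not depend on the value of L is also a
  conditional law given U alone.\<close>

lemma cond_law_drop_left:
  assumes "cond_law M (R \<Otimes>\<^sub>M S) T (\<lambda>x. (L x, U x)) V (\<lambda>(l, u). F u)" and F [measurable]: "F \<in> S \<rightarrow>\<^sub>M prob_algebra T"
    and L [measurable]: "L \<in> M \<rightarrow>\<^sub>M R" and U [measurable]: "U \<in> M \<rightarrow>\<^sub>M S"
  shows "cond_law M S T U V F"
  unfolding cond_law_def
proof (intro conjI ballI F)
  fix A B assume [measurable]: "A \<in> sets S" "B \<in> sets T"
  note [measurable] = measurable_prob_algebraD[OF F]
  have eq: "{x \<in> space M. U x \<in> A \<and> V x \<in> B} = {x \<in> space M. (L x, U x) \<in> space R \<times> A \<and> V x \<in> B}"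
    using measurable_space[OF L] by auto
  have "emeasure M {x \<in> space M. U x \<in> A \<and> V x \<in> B} =
      (\<integral>\<^sup>+p\<in>space R \<times> A. emeasure (case p of (l, u) \<Rightarrow> F u) B \<partial>distr M (R \<Otimes>\<^sub>M S) (\<lambda>x. (L x, U x)))"
    unfolding eq
    by (rule assms(1)[unfolded cond_law_def, THEN conjunct2, rule_format]) measurable
  also have "\<dots> = (\<integral>\<^sup>+p. emeasure (F (snd p)) B * indicator A (snd p) \<partial>distr M (R \<Otimes>\<^sub>M S) (\<lambda>x. (L x, U x)))"
    by (intro nn_integral_cong) (auto simp: indicator_def space_pair_measure)
  also have "\<dots> = (\<integral>\<^sup>+x. emeasure (F (U x)) B * indicator A (U x) \<partial>M)"
    by (subst nn_integral_distr) auto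
  also have "\<dots> = (\<integral>\<^sup>+u\<in>A. emeasure (F u) B \<partial>distr M S U)"
    by (subst nn_integral_distr) auto
  finally show "emeasure M {x \<in> space M. U x \<in> A \<and> V x \<in> B} = (\<integral>\<^sup>+u\<in>A. emeasure (F u) B \<partial>distr M S U)" .
qed

lemma cond_law_joint_density:
  fixes f :: "'b \<Rightarrow> 'c \<Rightarrow> real"
  assumes law: "cond_law M S T U V (\<lambda>u. density \<nu> (\<lambda>v. ennreal (f u v)))" and "prob_space M"
    and U [measurable]: "U \<in> M \<rightarrow>\<^sub>M S" and V [measurable]: "V \<in> M \<rightarrow>\<^sub>M T"
    and "sigma_finite_measure \<nu>" and \<nu> [measurable_cong]: "sets \<nu> = sets T"
    and f [measurable]: "(\<lambda>(u, v). f u v) \<in> borel_measurable (S \<Otimes>\<^sub>M T)"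
  shows "distr M (S \<Otimes>\<^sub>M T) (\<lambda>x. (U x, V x)) = density (distr M S U \<Otimes>\<^sub>M \<nu>) (\<lambda>(u, v). ennreal (f u v))"
proof (rule measure_eqI)
  interpret M: prob_space M by fact
  interpret U: prob_space "distr M S U" by (rule M.prob_space_distr[OF U])
  interpret \<nu>: sigma_finite_measure \<nu> by fact
  have sets_pair: "sets (distr M S U \<Otimes>\<^sub>M \<nu>) = sets (S \<Otimes>\<^sub>M T)"
    by (rule sets_pair_measure_cong) (simp_all add: \<nu>)
  then show "sets (distr M (S \<Otimes>\<^sub>M T) (\<lambda>x. (U x, V x))) =
      sets (density (distr M S U \<Otimes>\<^sub>M \<nu>) (\<lambda>(u, v). ennreal (f u v)))"
    by simp
  fix A assume "A \<in> sets (distr M (S \<Otimes>\<^sub>M T) (\<lambda>x. (U x, V x)))"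
  then have A [measurable]: "A \<in> sets (S \<Otimes>\<^sub>M T)" by simp
  have "emeasure (distr M (S \<Otimes>\<^sub>M T) (\<lambda>x. (U x, V x))) A = (\<integral>\<^sup>+x. indicator A (U x, V x) \<partial>M)"
    by (subst nn_integral_indicator[symmetric], simp, subst nn_integral_distr) auto
  also have "\<dots> = (\<integral>\<^sup>+u. \<integral>\<^sup>+v. indicator A (u, v) \<partial>density \<nu> (\<lambda>v. ennreal (f u v)) \<partial>distr M S U)"
    by (rule cond_law_nn_integral[OF law \<open>prob_space M\<close>]) measurable
  also have "\<dots> = (\<integral>\<^sup>+u. \<integral>\<^sup>+v. ennreal (f u v) * indicator A (u, v) \<partial>\<nu> \<partial>distr M S U)"
  proof (rule nn_integral_cong)
    fix u assume "u \<in> space (distr M S U)"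
    then have [measurable]: "u \<in> space S" by simp
    show "(\<integral>\<^sup>+v. indicator A (u, v) \<partial>density \<nu> (\<lambda>v. ennreal (f u v))) = (\<integral>\<^sup>+v. ennreal (f u v) * indicator A (u, v) \<partial>\<nu>)"
      by (rule nn_integral_density) measurable
  qed
  also have "\<dots> = (\<integral>\<^sup>+p. (case p of (u, v) \<Rightarrow> ennreal (f u v)) * indicator A p \<partial>(distr M S U \<Otimes>\<^sub>M \<nu>))"
    by (subst \<nu>.nn_integral_fst[symmetric]) auto
  also have "\<dots> = emeasure (density (distr M S U \<Otimes>\<^sub>M \<nu>) (\<lambda>(u, v). ennreal (f u v))) A"
    by (rule emeasure_density[symmetric]) measurable
  finally show "emeasure (distr M (S \<Otimes>\<^sub>M T) (\<lambda>x. (U x, V x))) A =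
      emeasure (density (distr M S U \<Otimes>\<^sub>M \<nu>) (\<lambda>(u, v). ennreal (f u v))) A" .
qed

text \<open>Each density \<open>f b\<close> integrates to 1, so the weight on the second coordinate
  does not disturb the first marginal.\<close>

lemma distr_fst_density_kernel:
  fixes f :: "'b \<Rightarrow> 'c \<Rightarrow> real"
  assumes P: "P \<in> space (prob_algebra S)" and "sigma_finite_measure \<nu>" and \<nu> [measurable_cong]: "sets \<nu> = sets T"
    and f [measurable]: "(\<lambda>(b, y). f b y) \<in> borel_measurable (S \<Otimes>\<^sub>M T)"
    and kernel: "(\<lambda>b. density \<nu> (\<lambda>y. ennreal (f b y))) \<in> S \<rightarrow>\<^sub>M prob_algebra T"
  shows "distr (density (P \<Otimes>\<^sub>M \<nu>) (\<lambda>(b, y). ennreal (f b y))) S fst = P"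
proof (rule measure_eqI)
  interpret \<nu>: sigma_finite_measure \<nu> by fact
  have [measurable_cong]: "sets P = sets S" using P by (simp add: space_prob_algebra)
  have space_P: "space P = space S" using P sets_eq_imp_space_eq by (auto simp: space_prob_algebra)
  show "sets (distr (density (P \<Otimes>\<^sub>M \<nu>) (\<lambda>(b, y). ennreal (f b y))) S fst) = sets P"
    using P by (simp add: space_prob_algebra)
  fix A assume "A \<in> sets (distr (density (P \<Otimes>\<^sub>M \<nu>) (\<lambda>(b, y). ennreal (f b y))) S fst)"
  then have A [measurable]: "A \<in> sets S" by simp
  have "emeasure (distr (density (P \<Otimes>\<^sub>M \<nu>) (\<lambda>(b, y). ennreal (f b y))) S fst) A =
      (\<integral>\<^sup>+p. indicator A (fst p) \<partial>density (P \<Otimes>\<^sub>M \<nu>) (\<lambda>(b, y). ennreal (f b y)))"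
    by (subst nn_integral_indicator[symmetric], simp, subst nn_integral_distr) auto
  also have "\<dots> = (\<integral>\<^sup>+p. (case p of (b, y) \<Rightarrow> ennreal (f b y)) * indicator A (fst p) \<partial>(P \<Otimes>\<^sub>M \<nu>))"
    by (rule nn_integral_density) measurable
  also have "\<dots> = (\<integral>\<^sup>+b. \<integral>\<^sup>+y. ennreal (f b y) * indicator A b \<partial>\<nu> \<partial>P)"
    by (subst \<nu>.nn_integral_fst[symmetric]) auto
  also have "\<dots> = (\<integral>\<^sup>+b. indicator A b \<partial>P)"
  proof (rule nn_integral_cong)
    fix b assume "b \<in> space P"
    then have b [measurable]: "b \<in> space S" by (simp add: space_P)
    have "(\<integral>\<^sup>+y. ennreal (f b y) \<partial>\<nu>) = emeasure (density \<nu> (\<lambda>y. ennreal (f b y))) (space T)"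
      by (subst emeasure_density) (auto simp: sets_eq_imp_space_eq[OF \<nu>] \<nu> intro!: nn_integral_cong)
    also have "\<dots> = 1"
      using measurable_space[OF kernel b] by (rule in_space_prob_algebra)
    finally show "(\<integral>\<^sup>+y. ennreal (f b y) * indicator A b \<partial>\<nu>) = indicator A b"
      by (subst nn_integral_multc) auto
  qed
  finally show "emeasure (distr (density (P \<Otimes>\<^sub>M \<nu>) (\<lambda>(b, y). ennreal (f b y))) S fst) A = emeasure P A"
    by simp
qed

section \<open>The chain rule for mutual information\<close>

text \<open>The space of L is arbitrary; second countability of the other two spaces enters through
  uniqueness of the conditional law of (U, V). The bound \<open>C\<close> keeps the mixtures of
  \<open>f\<close> finite, and positivity of \<open>f\<close> keeps all logarithms of ratios
  meaningful.\<close>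

theorem mutual_info_chain_rule:
  fixes M :: "'o measure" and L :: "'o \<Rightarrow> 'l"
    and U :: "'o \<Rightarrow> 'u :: second_countable_topology" and V :: "'o \<Rightarrow> 'v :: second_countable_topology"
    and f :: "'u \<Rightarrow> 'v \<Rightarrow> real"
  assumes "prob_space M"
    and L [measurable]: "L \<in> M \<rightarrow>\<^sub>M R" and U [measurable]: "U \<in> M \<rightarrow>\<^sub>M borel" and V [measurable]: "V \<in> M \<rightarrow>\<^sub>M borel"
    and "sigma_finite_measure \<nu>" and \<nu> [measurable_cong]: "sets \<nu> = sets borel"
    and f [measurable]: "(\<lambda>(u, v). f u v) \<in> borel_measurable (borel \<Otimes>\<^sub>M borel)"
    and f_pos: "\<And>u v. 0 < f u v" and f_le: "\<And>u v. f u v \<le> C"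
    and law_U: "cond_law M R borel L U P"
    and law_V: "cond_law M (R \<Otimes>\<^sub>M borel) borel (\<lambda>x. (L x, U x)) V (\<lambda>(l, u). density \<nu> (\<lambda>v. ennreal (f u v)))"
  shows "mutual_info M borel borel U V = mutual_info M R borel L V + cond_mutual_info M borel borel R U V L"
proof -
  interpret M: prob_space M by fact
  interpret \<nu>: sigma_finite_measure \<nu> by fact
  define D where "D = distr M R L"
  define F where "F = (\<lambda>u. density \<nu> (\<lambda>v. ennreal (f u v)))"
  define J where "J = (\<lambda>l. density (P l \<Otimes>\<^sub>M \<nu>) (\<lambda>(u, v). ennreal (f u v)))"
  interpret D: prob_space D unfolding D_def by (rule M.prob_space_distr[OF L])
  have [measurable_cong]: "sets D = sets R" by (simp add: D_def)
  have P [measurable]: "P \<in> R \<rightarrow>\<^sub>M prob_algebra borel" using law_U by (simp add: cond_law_def)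
  have P_sub [measurable]: "P \<in> R \<rightarrow>\<^sub>M subprob_algebra borel" by (rule measurable_prob_algebraD[OF P])
  have F: "F \<in> borel \<rightarrow>\<^sub>M prob_algebra borel"
  proof -
    \<comment> \<open>Measurability of the kernel in \<open>u\<close> is read off by fixing one
      value of L, which exists because the law of L has mass 1.\<close>
    obtain l where [measurable]: "l \<in> space R" using D.not_empty by (auto simp: D_def)
    have "(\<lambda>(l, u). F u) \<in> R \<Otimes>\<^sub>M borel \<rightarrow>\<^sub>M prob_algebra borel"
      using law_V by (simp add: cond_law_def F_def)
    from measurable_Pair2[OF this \<open>l \<in> space R\<close>] show ?thesis by simp
  qed
  have Pl: "P l \<in> space (prob_algebra borel)" if "l \<in> space R" for l
    using measurable_space[OF P that] .
  have P_sets: "sets (P l) = sets borel" and P_prob: "prob_space (P l)" if "l \<in> space R" for l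
    using Pl[OF that] by (auto simp: space_prob_algebra)
  have P_borel: "h \<in> borel_measurable (P l)" if "l \<in> space R" "h \<in> borel_measurable borel" for l and h :: "'u \<Rightarrow> ennreal"
    using that(2) by (simp add: measurable_cong_sets[OF P_sets[OF that(1)] refl])
  have J_bind: "P l \<bind> (\<lambda>u. distr (F u) (borel \<Otimes>\<^sub>M borel) (\<lambda>v. (u, v))) = J l" if "l \<in> space R" for l
    unfolding J_def F_def
    using that \<nu> \<nu>.sigma_finite_measure_axioms F f Pl by (intro bind_distr_density) (auto simp: F_def)
  have law_UV: "cond_law M R (borel \<Otimes>\<^sub>M borel) L (\<lambda>x. (U x, V x)) J"
  proof -
    have bind: "cond_law M R (borel \<Otimes>\<^sub>M borel) L (\<lambda>x. (U x, V x))
        (\<lambda>l. P l \<bind> (\<lambda>u. distr (F u) (borel \<Otimes>\<^sub>M borel) (\<lambda>v. (u, v))))"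
      using law_V by (intro cond_law_pair[OF law_U _ M.prob_space_axioms]) (auto simp: F_def)
    have "J \<in> R \<rightarrow>\<^sub>M prob_algebra (borel \<Otimes>\<^sub>M borel)"
      using bind by (simp add: cond_law_def J_bind cong: measurable_cong)
    moreover have "(\<integral>\<^sup>+l\<in>A. emeasure (P l \<bind> (\<lambda>u. distr (F u) (borel \<Otimes>\<^sub>M borel) (\<lambda>v. (u, v)))) B \<partial>distr M R L) =
        (\<integral>\<^sup>+l\<in>A. emeasure (J l) B \<partial>distr M R L)" for A B
      by (intro nn_integral_cong) (simp add: J_bind)
    ultimately show ?thesis
      using bind by (simp add: cond_law_def)
  qed
  have J [measurable]: "J \<in> R \<rightarrow>\<^sub>M prob_algebra (borel \<Otimes>\<^sub>M borel)"
    using law_UV by (simp add: cond_law_def)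
  have J_sub: "J \<in> R \<rightarrow>\<^sub>M subprob_algebra (borel \<Otimes>\<^sub>M borel)"
    by (rule measurable_prob_algebraD[OF J])
  have J_sets: "sets (J l) = sets (borel \<Otimes>\<^sub>M borel)" and J_prob: "prob_space (J l)" if "l \<in> space R" for l
    using measurable_space[OF J that] by (auto simp: space_prob_algebra)
  have space_\<nu>: "space \<nu> = UNIV" using sets_eq_imp_space_eq[OF \<nu>] by simp

  define h where "h = (\<lambda>l v. enn2real (\<integral>\<^sup>+u. ennreal (f u v) \<partial>P l))"
  define g where "g = (\<lambda>v. enn2real (\<integral>\<^sup>+u. ennreal (f u v) \<partial>distr M borel U))"
  \<comment> \<open>\<open>enn2real\<close> sends infinity to 0, so \<open>h\<close> and
    \<open>g\<close> stand for the mixtures only if these are finite; the bound on \<open>f\<close>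
    ensures this. A zero mixture would force \<open>f\<close> to vanish almost everywhere.\<close>
  have mixture: "\<exists>r>0. (\<integral>\<^sup>+u. ennreal (f u v) \<partial>p) = ennreal r"
    if "prob_space p" "sets p = sets borel" for p v
  proof -
    interpret p: prob_space p by fact
    have [measurable]: "(\<lambda>u. ennreal (f u v)) \<in> borel_measurable p"
      unfolding measurable_cong_sets[OF that(2) refl] by measurable
    have "(\<integral>\<^sup>+u. ennreal (f u v) \<partial>p) \<le> (\<integral>\<^sup>+u. ennreal C \<partial>p)"
      by (intro nn_integral_mono ennreal_leI f_le)
    also have "\<dots> = ennreal C" by (simp add: p.emeasure_space_1)
    finally have "(\<integral>\<^sup>+u. ennreal (f u v) \<partial>p) \<noteq> \<infinity>" by (auto simp: top_unique)
    moreover have "(\<integral>\<^sup>+u. ennreal (f u v) \<partial>p) \<noteq> 0"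
    proof
      assume "(\<integral>\<^sup>+u. ennreal (f u v) \<partial>p) = 0"
      then have "AE u in p. ennreal (f u v) = 0" by (simp add: nn_integral_0_iff_AE)
      then have "AE u in p. False"
      proof (rule eventually_mono)
        show "ennreal (f u v) = 0 \<Longrightarrow> False" for u using f_pos[of u v] by simp
      qed
      then show False using p.AE_False by simp
    qed
    ultimately show ?thesis
      by (cases "\<integral>\<^sup>+u. ennreal (f u v) \<partial>p") (auto intro!: exI less_le[THEN iffD2])
  qed
  have h: "0 < h l v" "(\<integral>\<^sup>+u. ennreal (f u v) \<partial>P l) = ennreal (h l v)" if "l \<in> space R" for l v
    using mixture[OF P_prob P_sets, OF that that, of v] by (auto simp: h_def)
  have g: "0 < g v" "(\<integral>\<^sup>+u. ennreal (f u v) \<partial>distr M borel U) = ennreal (g v)" for v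
    using mixture[OF M.prob_space_distr[OF U], of v] by (auto simp: g_def)
  have h_meas [measurable]: "(\<lambda>(l, v). h l v) \<in> borel_measurable (R \<Otimes>\<^sub>M borel)"
  proof -
    have [measurable]: "(\<lambda>p. P (fst p)) \<in> R \<Otimes>\<^sub>M borel \<rightarrow>\<^sub>M subprob_algebra borel" by measurable
    have "(\<lambda>p. \<integral>\<^sup>+u. ennreal (f u (snd p)) \<partial>P (fst p)) \<in> borel_measurable (R \<Otimes>\<^sub>M borel)"
      by (rule nn_integral_measurable_subprob_algebra2[where N = borel]) measurable
    then show ?thesis by (simp add: h_def case_prod_beta')
  qed
  have g_meas [measurable]: "g \<in> borel_measurable borel"
  proof -
    interpret U: prob_space "distr M borel U" by (rule M.prob_space_distr[OF U])
    show ?thesis unfolding g_def by measurable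
  qed
  have tower: "(\<integral>\<^sup>+x. G (L x) (U x, V x) \<partial>M) = (\<integral>\<^sup>+l. \<integral>\<^sup>+p. G l p \<partial>J l \<partial>D)"
    if "(\<lambda>(l, p). G l p) \<in> borel_measurable (R \<Otimes>\<^sub>M (borel \<Otimes>\<^sub>M borel))" for G
    using cond_law_nn_integral[OF law_UV M.prob_space_axioms L _ that] by (simp add: D_def)

  have law_V': "cond_law M borel borel U V F"
    using law_V F by (intro cond_law_drop_left[OF _ F L U]) (simp add: F_def)
  have joint_UV: "distr M (borel \<Otimes>\<^sub>M borel) (\<lambda>x. (U x, V x)) =
      density (distr M borel U \<Otimes>\<^sub>M \<nu>) (\<lambda>(u, v). ennreal (f u v))"
    by (rule cond_law_joint_density[OF law_V'[unfolded F_def] M.prob_space_axioms U V \<nu>.sigma_finite_measure_axioms \<nu> f])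
  note mi_UV = mutual_info_density[OF M.prob_space_axioms U V \<nu>.sigma_finite_measure_axioms \<nu> f f_pos g_meas g(1) g(2) joint_UV]

  \<comment> \<open>Integrating \<open>u\<close> out of the conditional law of (U, V) given L makes
    \<open>h l\<close> the conditional density of V.\<close>
  have joint_LV: "distr M (R \<Otimes>\<^sub>M borel) (\<lambda>x. (L x, V x)) = density (D \<Otimes>\<^sub>M \<nu>) (\<lambda>(l, v). ennreal (h l v))"
  proof (rule measure_eqI)
    have sets_pair: "sets (D \<Otimes>\<^sub>M \<nu>) = sets (R \<Otimes>\<^sub>M borel)"
      by (rule sets_pair_measure_cong) (simp_all add: \<nu> D_def)
    then show "sets (distr M (R \<Otimes>\<^sub>M borel) (\<lambda>x. (L x, V x))) = sets (density (D \<Otimes>\<^sub>M \<nu>) (\<lambda>(l, v). ennreal (h l v)))"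
      by simp
    fix A assume "A \<in> sets (distr M (R \<Otimes>\<^sub>M borel) (\<lambda>x. (L x, V x)))"
    then have A [measurable]: "A \<in> sets (R \<Otimes>\<^sub>M borel)" by simp
    have "emeasure (distr M (R \<Otimes>\<^sub>M borel) (\<lambda>x. (L x, V x))) A = (\<integral>\<^sup>+x. indicator A (L x, snd (U x, V x)) \<partial>M)"
      by (subst nn_integral_indicator[symmetric], simp, subst nn_integral_distr) auto
    also have "\<dots> = (\<integral>\<^sup>+l. \<integral>\<^sup>+p. indicator A (l, snd p) \<partial>J l \<partial>D)"
      by (rule tower) measurable
    also have "\<dots> = (\<integral>\<^sup>+l. \<integral>\<^sup>+v. ennreal (h l v) * indicator A (l, v) \<partial>\<nu> \<partial>D)"
    proof (rule nn_integral_cong)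
      fix l assume "l \<in> space D"
      then have l [measurable]: "l \<in> space R" by (simp add: D_def)
      interpret Pl: prob_space "P l" by (rule P_prob[OF l])
      interpret pair_sigma_finite "P l" \<nu> ..
      have [measurable_cong]: "sets (P l) = sets borel" by (rule P_sets[OF l])
      have sets_pair: "sets (P l \<Otimes>\<^sub>M \<nu>) = sets (borel \<Otimes>\<^sub>M borel)"
        by (rule sets_pair_measure_cong[OF P_sets[OF l] \<nu>])
      have [measurable]: "(\<lambda>p. indicator A (l, snd p) :: ennreal) \<in> borel_measurable (P l \<Otimes>\<^sub>M \<nu>)"
        unfolding measurable_cong_sets[OF sets_pair refl] by measurable
      have [measurable]: "(\<lambda>(u, v). ennreal (f u v)) \<in> borel_measurable (P l \<Otimes>\<^sub>M \<nu>)"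
        unfolding measurable_cong_sets[OF sets_pair refl] by measurable
      have "(\<integral>\<^sup>+p. indicator A (l, snd p) \<partial>J l) =
          (\<integral>\<^sup>+p. (case p of (u, v) \<Rightarrow> ennreal (f u v)) * indicator A (l, snd p) \<partial>(P l \<Otimes>\<^sub>M \<nu>))"
        unfolding J_def by (rule nn_integral_density) measurable
      also have "\<dots> = (\<integral>\<^sup>+v. \<integral>\<^sup>+u. ennreal (f u v) * indicator A (l, v) \<partial>P l \<partial>\<nu>)"
        by (subst nn_integral_snd[symmetric]) auto
      also have "\<dots> = (\<integral>\<^sup>+v. ennreal (h l v) * indicator A (l, v) \<partial>\<nu>)"
        by (intro nn_integral_cong) (simp add: nn_integral_multc h(2)[OF l])
      finally show "(\<integral>\<^sup>+p. indicator A (l, snd p) \<partial>J l) = (\<integral>\<^sup>+v. ennreal (h l v) * indicator A (l, v) \<partial>\<nu>)" .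
    qed
    also have "\<dots> = (\<integral>\<^sup>+p. (case p of (l, v) \<Rightarrow> ennreal (h l v)) * indicator A p \<partial>(D \<Otimes>\<^sub>M \<nu>))"
      by (subst \<nu>.nn_integral_fst[symmetric]) auto
    also have "\<dots> = emeasure (density (D \<Otimes>\<^sub>M \<nu>) (\<lambda>(l, v). ennreal (h l v))) A"
      by (rule emeasure_density[symmetric]) measurable
    finally show "emeasure (distr M (R \<Otimes>\<^sub>M borel) (\<lambda>x. (L x, V x))) A =
        emeasure (density (D \<Otimes>\<^sub>M \<nu>) (\<lambda>(l, v). ennreal (h l v))) A" .
  qed
  \<comment> \<open>By the tower property, averaging \<open>h\<close> over L gives the same
    \<open>g\<close> as averaging \<open>f\<close> over U, so both ratios share one
    denominator.\<close>
  have g_h: "(\<integral>\<^sup>+l. ennreal (h l v) \<partial>distr M R L) = ennreal (g v)" for v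
  proof -
    have "ennreal (g v) = (\<integral>\<^sup>+x. ennreal (f (U x) v) \<partial>M)"
      by (simp add: g(2)[symmetric] nn_integral_distr)
    also have "\<dots> = (\<integral>\<^sup>+l. \<integral>\<^sup>+u. ennreal (f u v) \<partial>P l \<partial>distr M R L)"
      using cond_law_nn_integral[OF law_U M.prob_space_axioms L U, of "\<lambda>(l, u). ennreal (f u v)"] by simp
    also have "\<dots> = (\<integral>\<^sup>+l. ennreal (h l v) \<partial>distr M R L)"
      by (intro nn_integral_cong) (simp add: h(2))
    finally show ?thesis ..
  qed
  have h_pos: "0 < h l v" if "l \<in> space R" "v \<in> space borel" for l v
    by (rule h(1)[OF that(1)])
  note mi_LV = mutual_info_density[OF M.prob_space_axioms L V \<nu>.sigma_finite_measure_axioms \<nu> h_meas h_pos g_meas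
      g(1) g_h joint_LV[unfolded D_def]]

  define I where "I = (\<lambda>l. e2ennreal (mutual_info (J l) borel borel fst snd))"
  define pos where "pos = (\<lambda>l (u, v). ennreal (ln (f u v / h l v)))"
  define neg where "neg = (\<lambda>l (u, v). ennreal (- ln (f u v / h l v)))"
  have pos [measurable]: "(\<lambda>(l, p). pos l p) \<in> borel_measurable (R \<Otimes>\<^sub>M (borel \<Otimes>\<^sub>M borel))"
    unfolding pos_def case_prod_beta' by measurable
  have neg [measurable]: "(\<lambda>(l, p). neg l p) \<in> borel_measurable (R \<Otimes>\<^sub>M (borel \<Otimes>\<^sub>M borel))"
    unfolding neg_def case_prod_beta' by measurable
  \<comment> \<open>The third use of the density lemma: under \<open>J l\<close> the first marginal
    is \<open>P l\<close>, and the mixture in the denominator is \<open>h l\<close>.\<close>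
  have mi_J: "(\<integral>\<^sup>+p. pos l p \<partial>J l) = I l + (\<integral>\<^sup>+p. neg l p \<partial>J l)" "(\<integral>\<^sup>+p. neg l p \<partial>J l) \<le> 1"
    if l [measurable]: "l \<in> space R" for l
  proof -
    have [measurable_cong]: "sets (J l) = sets (borel \<Otimes>\<^sub>M borel)" by (rule J_sets[OF l])
    have marginal: "distr (J l) borel fst = P l"
      unfolding J_def
      by (rule distr_fst_density_kernel[OF Pl[OF l] \<nu>.sigma_finite_measure_axioms \<nu> f F[unfolded F_def]])
    have "distr (J l) (borel \<Otimes>\<^sub>M borel) (\<lambda>p. (fst p, snd p)) = J l"
      using distr_id2[of "borel \<Otimes>\<^sub>M borel" "J l"] J_sets[OF l] by simp
    then have joint: "distr (J l) (borel \<Otimes>\<^sub>M borel) (\<lambda>p. (fst p, snd p)) =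
        density (distr (J l) borel fst \<Otimes>\<^sub>M \<nu>) (\<lambda>(u, v). ennreal (f u v))"
      unfolding marginal by (simp add: J_def)
    note mi = mutual_info_density[OF J_prob[OF l] _ _ \<nu>.sigma_finite_measure_axioms \<nu> f f_pos _ h(1)[OF l]
        h(2)[OF l, folded marginal] joint]
    show "(\<integral>\<^sup>+p. pos l p \<partial>J l) = I l + (\<integral>\<^sup>+p. neg l p \<partial>J l)"
      unfolding pos_def neg_def I_def case_prod_beta by (rule mi(2)) measurable
    show "(\<integral>\<^sup>+p. neg l p \<partial>J l) \<le> 1"
      unfolding neg_def case_prod_beta by (rule mi(3)) measurable
  qed
  have pos_int [measurable]: "(\<lambda>l. \<integral>\<^sup>+p. pos l p \<partial>J l) \<in> borel_measurable R"
    by (rule nn_integral_measurable_subprob_algebra2[OF pos J_sub])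
  have neg_int [measurable]: "(\<lambda>l. \<integral>\<^sup>+p. neg l p \<partial>J l) \<in> borel_measurable R"
    by (rule nn_integral_measurable_subprob_algebra2[OF neg J_sub])
  \<comment> \<open>The mutual information of \<open>J l\<close> is recovered as a difference of two
    integrals measurable in \<open>l\<close>; the subtracted one is at most 1, so the difference is
    legitimate.\<close>
  have [measurable]: "I \<in> borel_measurable R"
  proof -
    have "I l = (\<integral>\<^sup>+p. pos l p \<partial>J l) - (\<integral>\<^sup>+p. neg l p \<partial>J l)" if "l \<in> space R" for l
    proof -
      have "(\<integral>\<^sup>+p. neg l p \<partial>J l) \<noteq> top" using mi_J(2)[OF that] by (auto simp: top_unique)
      then show ?thesis by (simp add: mi_J(1)[OF that] ennreal_add_diff_cancel_right)
    qed
    then have "I \<in> borel_measurable R \<longleftrightarrow> (\<lambda>l. (\<integral>\<^sup>+p. pos l p \<partial>J l) - (\<integral>\<^sup>+p. neg l p \<partial>J l)) \<in> borel_measurable R"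
      by (rule measurable_cong)
    then show ?thesis by simp
  qed
  define I3 where "I3 = (\<integral>\<^sup>+l. I l \<partial>D)"
  \<comment> \<open>The kernel chosen in \<open>cond_mutual_info\<close> agrees with
    \<open>J\<close> for almost every value of L, so it may be replaced inside the average.\<close>
  have cmi: "cond_mutual_info M borel borel R U V L = enn2ereal I3"
  proof -
    define K' where "K' = (SOME K. cond_law M R (borel \<Otimes>\<^sub>M borel) L (\<lambda>x. (U x, V x)) K)"
    have "cond_law M R (borel \<Otimes>\<^sub>M borel) L (\<lambda>x. (U x, V x)) K'"
      unfolding K'_def using law_UV
      by (rule someI[where P = "cond_law M R (borel \<Otimes>\<^sub>M borel) L (\<lambda>x. (U x, V x))"])
    then have "AE l in D. K' l = J l"
      using law_UV M.prob_space_axioms L unfolding D_def borel_prod by (rule cond_law_unique)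
    then have "(\<integral>\<^sup>+l. e2ennreal (mutual_info (K' l) borel borel fst snd) \<partial>D) = I3"
      unfolding I3_def I_def by (intro nn_integral_cong_AE) auto
    then show ?thesis
      by (simp add: cond_mutual_info_def K'_def D_def)
  qed

  let ?p1 = "\<integral>\<^sup>+x. ennreal (ln (f (U x) (V x) / g (V x))) \<partial>M" and ?n1 = "\<integral>\<^sup>+x. ennreal (- ln (f (U x) (V x) / g (V x))) \<partial>M"
  let ?p2 = "\<integral>\<^sup>+x. ennreal (ln (h (L x) (V x) / g (V x))) \<partial>M" and ?n2 = "\<integral>\<^sup>+x. ennreal (- ln (h (L x) (V x) / g (V x))) \<partial>M"
  let ?p3 = "\<integral>\<^sup>+x. pos (L x) (U x, V x) \<partial>M" and ?n3 = "\<integral>\<^sup>+x. neg (L x) (U x, V x) \<partial>M"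
  let ?c1 = "e2ennreal (mutual_info M borel borel U V)" and ?c2 = "e2ennreal (mutual_info M R borel L V)"
  have c1: "?p1 = ?c1 + ?n1" "?n1 \<le> 1"
    using mi_UV by simp_all
  have c2: "?p2 = ?c2 + ?n2" "?n2 \<le> 1"
    using mi_LV by simp_all
  have "?p3 = (\<integral>\<^sup>+l. I l + (\<integral>\<^sup>+p. neg l p \<partial>J l) \<partial>D)"
    unfolding tower[OF pos] by (intro nn_integral_cong) (simp add: D_def mi_J)
  also have "\<dots> = I3 + ?n3"
    unfolding tower[OF neg] I3_def by (rule nn_integral_add) measurable
  finally have c3: "?p3 = I3 + ?n3" .
  have "?n3 \<le> (\<integral>\<^sup>+l. 1 \<partial>D)"
    unfolding tower[OF neg] by (intro nn_integral_mono) (simp add: D_def mi_J)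
  then have n3: "?n3 \<le> 1" by (simp add: D.emeasure_space_1)
  \<comment> \<open>\<open>ln (f/g) = ln (h/g) + ln (f/h)\<close>, with negative parts moved across so that no subtraction occurs.\<close>
  have "?p1 + (?n2 + ?n3) = ?n1 + (?p2 + ?p3)"
  proof -
    have "?p1 + (?n2 + ?n3) = (\<integral>\<^sup>+x. ennreal (ln (f (U x) (V x) / g (V x))) +
        (ennreal (- ln (h (L x) (V x) / g (V x))) + neg (L x) (U x, V x)) \<partial>M)"
      by (simp add: nn_integral_add)
    also have "\<dots> = (\<integral>\<^sup>+x. ennreal (- ln (f (U x) (V x) / g (V x))) +
        (ennreal (ln (h (L x) (V x) / g (V x))) + pos (L x) (U x, V x)) \<partial>M)"
    proof (rule nn_integral_cong)
      fix x assume "x \<in> space M"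
      then have "L x \<in> space R" using measurable_space[OF L] by simp
      then have "ln (f (U x) (V x) / g (V x)) = ln (h (L x) (V x) / g (V x)) + ln (f (U x) (V x) / h (L x) (V x))"
        using f_pos[of "U x" "V x"] g(1)[of "V x"] h(1)[of "L x" "V x"] by (simp add: ln_div)
      moreover have "ennreal (a + b) + (ennreal (- a) + ennreal (- b)) = ennreal (- (a + b)) + (ennreal a + ennreal b)" for a b :: real
        by (cases "0 \<le> a"; cases "0 \<le> b"; cases "0 \<le> a + b")
          (simp_all add: ennreal_neg ennreal_plus[symmetric] del: ennreal_plus)
      ultimately show "ennreal (ln (f (U x) (V x) / g (V x))) + (ennreal (- ln (h (L x) (V x) / g (V x))) + neg (L x) (U x, V x)) =
          ennreal (- ln (f (U x) (V x) / g (V x))) + (ennreal (ln (h (L x) (V x) / g (V x))) + pos (L x) (U x, V x))"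
        by (simp only: pos_def neg_def prod.case)
    qed
    also have "\<dots> = ?n1 + (?p2 + ?p3)"
      by (simp add: nn_integral_add)
    finally show ?thesis .
  qed
  then have "(?n1 + ?n2 + ?n3) + ?c1 = (?n1 + ?n2 + ?n3) + (?c2 + I3)"
    unfolding c1(1) c2(1) c3 by (simp add: ac_simps)
  \<comment> \<open>The three negative parts add up to at most 3, so they can be cancelled in
    [0, infinity] even if the informations are infinite.\<close>
  moreover have "?n1 + ?n2 + ?n3 \<noteq> top"
    using c1(2) c2(2) n3 by (auto simp: top_unique)
  ultimately have "?c1 = ?c2 + I3"
    by (simp add: ennreal_add_left_cancel)
  then have "enn2ereal ?c1 = enn2ereal ?c2 + enn2ereal I3"
    by (simp add: plus_ennreal.rep_eq)
  then show "mutual_info M borel borel U V = mutual_info M R borel L V + cond_mutual_info M borel borel R U V L"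
    using mi_UV(1) mi_LV(1) by (simp add: enn2ereal_e2ennreal cmi)
qed

section \<open>The Gaussian scale mixture model\<close>

lemma matrix_vector_mult_vec_lambda: "(X :: real ^ 'p ^ 'n) *v vec_lambda x = (\<Sum>j\<in>UNIV. x j *\<^sub>R column j X)"
  by (simp add: matrix_mult_sum scalar_mult_eq_scaleR)

lemma prior_eq: "prior (lam, tau) = normal_vec 0 (\<chi> j. tau * lam $ j)"
  by (simp add: prior_def)

lemma scale_space_pos:
  assumes "(lam, tau) \<in> space (scale_space :: ((real ^ 'p) \<times> real) measure)"
  shows "0 < (\<chi> j. tau * lam $ j) $ j"
  using assms by (simp add: scale_space_def space_restrict_space)

definition gaussian_kernel :: "real ^ 'p ^ 'n \<Rightarrow> real \<Rightarrow> real ^ 'p \<Rightarrow> real ^ 'n \<Rightarrow> real" where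
  "gaussian_kernel X \<sigma> b y = gauss (\<sigma>\<^sup>2 *\<^sub>R mat 1) (y - X *v b)"

lemma likelihood_eq_density:
  assumes "0 < \<sigma>"
  shows "likelihood X \<sigma> b = density lborel (\<lambda>y. ennreal (gaussian_kernel X \<sigma> b y))"
  using assms normal_vec_eq_density[of "\<chi> i. \<sigma>" "X *v b"]
  by (simp add: likelihood_def gaussian_kernel_def prod_normal_density_eq_gauss[symmetric])

lemma gaussian_kernel_measurable [measurable]:
  "(\<lambda>(b, y). gaussian_kernel X \<sigma> b y) \<in> borel_measurable (borel \<Otimes>\<^sub>M borel)"
proof -
  have [measurable]: "(\<lambda>b. X *v b) \<in> borel_measurable borel"
    by (intro borel_measurable_continuous_onI continuous_intros)
  show ?thesis unfolding gaussian_kernel_def by measurable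
qed

lemma gaussian_kernel_pos: "0 < \<sigma> \<Longrightarrow> 0 < gaussian_kernel X \<sigma> b y"
  by (simp add: gaussian_kernel_def gauss_pos psd_scaled_identity)

text \<open>The exponent is nonpositive, so the bound is the value at y = X b; it supplies the
  constant \<open>C\<close> of \<open>mutual_info_chain_rule\<close>.\<close>

lemma gaussian_kernel_bounded:
  fixes X :: "real ^ 'p ^ 'n"
  assumes "0 < \<sigma>"
  shows "gaussian_kernel X \<sigma> b y \<le> 1 / sqrt ((2 * pi) ^ CARD('n) * det (\<sigma>\<^sup>2 *\<^sub>R mat 1 :: real ^ 'n ^ 'n))"
  using psd_scaled_identity(2)[OF assms, where 'n = 'n] psd_inverse(4)[OF psd_scaled_identity(2)[OF assms, where 'n = 'n]]
  by (simp add: gaussian_kernel_def gauss_def psd_def divide_right_mono)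

text \<open>X b is the combination of the columns of X with the independent coordinates of b as
  weights, which is the setting of \<open>nn_integral_PiM_gauss\<close>.\<close>

lemma nn_integral_prior_gaussian_kernel:
  fixes X :: "real ^ 'p ^ 'n"
  assumes "0 < \<sigma>" and s: "\<And>j. 0 < s $ j"
  shows "(\<integral>\<^sup>+b. ennreal (gaussian_kernel X \<sigma> b y) \<partial>normal_vec 0 s) =
    ennreal (gauss (\<sigma>\<^sup>2 *\<^sub>R mat 1 + (\<Sum>j\<in>UNIV. (s $ j)\<^sup>2 *\<^sub>R outer (column j X) (column j X))) y)"
proof -
  have "(\<integral>\<^sup>+b. ennreal (gaussian_kernel X \<sigma> b y) \<partial>normal_vec 0 s) =
      (\<integral>\<^sup>+x. ennreal (gaussian_kernel X \<sigma> (vec_lambda x) y)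
        \<partial>(\<Pi>\<^sub>M i\<in>UNIV. density lborel (\<lambda>t. ennreal (normal_density 0 (s $ i) t))))"
    unfolding normal_vec_def by (subst nn_integral_distr) auto
  then show ?thesis
    unfolding gaussian_kernel_def matrix_vector_mult_vec_lambda
    using nn_integral_PiM_gauss[OF finite psd_scaled_identity(2)[OF assms(1)] s] by simp
qed

text \<open>Identifies the covariance accumulated one coefficient at a time with the matrix in the
  claimed formula; it rests on the diagonality of \<open>Sigma_scales\<close>.\<close>

lemma covariance_eq:
  fixes X :: "real ^ 'p ^ 'n"
  shows "(\<Sum>j\<in>UNIV. ((\<chi> j. tau * lam $ j) $ j)\<^sup>2 *\<^sub>R outer (column j X) (column j X)) = X ** Sigma_scales lam tau ** transpose X"
proof -
  have "(\<Sum>k\<in>UNIV. (\<Sum>l\<in>UNIV. X $ i $ l * (if l = k then tau\<^sup>2 * (lam $ l)\<^sup>2 else 0)) * X $ j $ k) =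
      (\<Sum>k\<in>UNIV. tau\<^sup>2 * (lam $ k)\<^sup>2 * (X $ i $ k * X $ j $ k))" for i j
    by (simp add: if_distrib cong: if_cong) (simp add: mult_ac)
  then show ?thesis
    by (simp add: vec_eq_iff matrix_matrix_mult_def Sigma_scales_def outer_def column_def transpose_def power_mult_distrib)
qed

lemma diagonal_quadratic_trace:
  fixes A :: "real ^ 'p ^ 'p"
  shows "(\<Sum>j\<in>UNIV. A $ j $ j * ((\<chi> j. tau * lam $ j) $ j)\<^sup>2) = trace (A ** Sigma_scales lam tau)"
  by (simp add: trace_def matrix_matrix_mult_def Sigma_scales_def power_mult_distrib if_distrib cong: if_cong)

lemma nn_integral_joint_given:
  fixes X :: "real ^ 'p ^ 'n"
  assumes lik: "likelihood X \<sigma> \<in> borel \<rightarrow>\<^sub>M prob_algebra borel" and l: "l \<in> space scale_space"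
    and [measurable]: "F \<in> borel_measurable (borel \<Otimes>\<^sub>M borel)"
  shows "(\<integral>\<^sup>+p. F p \<partial>joint_given X \<sigma> l) = (\<integral>\<^sup>+b. \<integral>\<^sup>+y. F (b, y) \<partial>likelihood X \<sigma> b \<partial>prior l)"
proof -
  note [measurable] = lik
  obtain lam tau where [simp]: "l = (lam, tau)" by (cases l)
  have [measurable_cong]: "sets (prior l) = sets borel" by (simp add: prior_eq)
  have kernel: "(\<lambda>b. distr (likelihood X \<sigma> b) (borel \<Otimes>\<^sub>M borel) (\<lambda>y. (b, y))) \<in>
      prior l \<rightarrow>\<^sub>M prob_algebra (borel \<Otimes>\<^sub>M borel)"
    by measurable
  have "(\<integral>\<^sup>+p. F p \<partial>joint_given X \<sigma> l) =
      (\<integral>\<^sup>+b. \<integral>\<^sup>+p. F p \<partial>distr (likelihood X \<sigma> b) (borel \<Otimes>\<^sub>M borel) (\<lambda>y. (b, y)) \<partial>prior l)"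
    unfolding joint_given_def by (rule nn_integral_bind[OF _ measurable_prob_algebraD[OF kernel]]) measurable
  also have "\<dots> = (\<integral>\<^sup>+b. \<integral>\<^sup>+y. F (b, y) \<partial>likelihood X \<sigma> b \<partial>prior l)"
    by (intro nn_integral_cong nn_integral_distr) (auto simp: likelihood_def)
  finally show ?thesis .
qed

section \<open>Closed form of the mutual information for fixed scales\<close>

lemma mutual_info_joint_given:
  fixes X :: "real ^ 'p ^ 'n"
  assumes \<sigma>: "0 < \<sigma>" and lik: "likelihood X \<sigma> \<in> borel \<rightarrow>\<^sub>M prob_algebra borel"
    and l: "(lam, tau) \<in> space scale_space"
  shows "mutual_info (joint_given X \<sigma> (lam, tau)) borel borel fst snd =
    ereal (1 / 2 * ln (det (mat 1 + (1 / \<sigma>\<^sup>2) *\<^sub>R (X ** Sigma_scales lam tau ** transpose X))))"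
proof -
  define s where "s = (\<chi> j. tau * lam $ j)"
  define J where "J = joint_given X \<sigma> (lam, tau)"
  define C where "C = \<sigma>\<^sup>2 *\<^sub>R mat 1 + X ** Sigma_scales lam tau ** transpose X"
  define Q where "Q = matrix_inv C"
  define f where "f = gaussian_kernel X \<sigma>"
  note s = scale_space_pos[OF l, folded s_def]
  have prior: "prior (lam, tau) = normal_vec 0 s" by (simp add: prior_eq s_def)
  interpret prior: prob_space "normal_vec 0 s" by (rule prob_space_normal_vec[OF s])
  have C: "psd C"
    using psd_add_outer_sum[OF finite[of UNIV] psd_scaled_identity(2)[OF \<sigma>], of "\<lambda>j. s $ j" "\<lambda>j. column j X"]
    unfolding C_def s_def covariance_eq .
  note Q = psd_inverse[OF C, folded Q_def]
  have [measurable]: "(\<lambda>b. X *v b) \<in> borel_measurable borel" "(\<lambda>y. Q *v y) \<in> borel_measurable borel"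
    by (intro borel_measurable_continuous_onI continuous_intros)+
  have kernel: "(\<lambda>b. density lborel (\<lambda>y. ennreal (f b y))) \<in> borel \<rightarrow>\<^sub>M prob_algebra borel"
    using lik unfolding f_def likelihood_eq_density[OF \<sigma>, symmetric] .
  have prior_prob: "normal_vec 0 s \<in> space (prob_algebra borel)"
    by (simp add: space_prob_algebra prior.prob_space_axioms)
  have f [measurable]: "(\<lambda>(b, y). f b y) \<in> borel_measurable (borel \<Otimes>\<^sub>M borel)"
    unfolding f_def by measurable
  have J_density: "J = density (normal_vec 0 s \<Otimes>\<^sub>M lborel) (\<lambda>(b, y). ennreal (f b y))"
    unfolding J_def joint_given_def prior likelihood_eq_density[OF \<sigma>] f_def[symmetric]
    by (rule bind_distr_density[OF prior_prob _ _ f kernel]) (auto intro: sigma_finite_lborel)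
  have J_sets [measurable_cong]: "sets J = sets (borel \<Otimes>\<^sub>M borel)"
    unfolding J_density sets_density by (rule sets_pair_measure_cong) simp_all
  have J_prob: "prob_space J"
    unfolding J_def joint_given_def prior using prior_prob
    by (rule prob_space_bind') (use lik in measurable)
  interpret J: prob_space J by fact
  have marginal: "distr J borel fst = normal_vec 0 s"
    unfolding J_density
    by (rule distr_fst_density_kernel[OF prior_prob _ _ f kernel]) (auto intro: sigma_finite_lborel)
  have "distr J (borel \<Otimes>\<^sub>M borel) (\<lambda>p. (fst p, snd p)) = J"
    using distr_id2[of "borel \<Otimes>\<^sub>M borel" J] J_sets by simp
  then have joint: "distr J (borel \<Otimes>\<^sub>M borel) (\<lambda>p. (fst p, snd p)) =
      density (distr J borel fst \<Otimes>\<^sub>M lborel) (\<lambda>(b, y). ennreal (f b y))"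
    unfolding marginal by (simp add: J_density)
  have mixture: "(\<integral>\<^sup>+b. ennreal (f b y) \<partial>distr J borel fst) = ennreal (gauss C y)" for y
    using nn_integral_prior_gaussian_kernel[OF \<sigma> s, of X y]
    unfolding marginal f_def C_def s_def covariance_eq .
  have f_pos: "0 < f b y" for b y
    unfolding f_def using \<sigma> by (rule gaussian_kernel_pos)
  have "fst \<in> J \<rightarrow>\<^sub>M borel" "snd \<in> J \<rightarrow>\<^sub>M borel"
    unfolding measurable_cong_sets[OF J_sets refl] by simp_all
  note mi = mutual_info_density[OF J_prob this sigma_finite_lborel sets_lborel f f_pos
      gauss_measurable gauss_pos[OF C] mixture joint]

  \<comment> \<open>Given b the residual is pure noise, with expected square norm n sigma^2 whatever
    b is. The integrand is nonnegative, so the iterated integral yields integrability and value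
    together.\<close>
  have residual: "has_bochner_integral J (\<lambda>p. (snd p - X *v fst p) \<bullet> (snd p - X *v fst p)) (CARD('n) * \<sigma>\<^sup>2)"
  proof (rule has_bochner_integral_nn_integral)
    have "(\<integral>\<^sup>+y. ennreal ((y - X *v b) \<bullet> (y - X *v b)) \<partial>likelihood X \<sigma> b) = ennreal (CARD('n) * \<sigma>\<^sup>2)" for b
    proof -
      have "(\<Sum>i\<in>UNIV. (mat 1 :: real ^ 'n ^ 'n) $ i $ i * ((\<chi> i. \<sigma>) $ i)\<^sup>2) = CARD('n) * \<sigma>\<^sup>2"
        by (simp add: mat_def)
      with normal_vec_centered_quadratic[of "\<chi> i. \<sigma>" "X *v b" "mat 1"] \<sigma>
      have "has_bochner_integral (likelihood X \<sigma> b) (\<lambda>y. (y - X *v b) \<bullet> (y - X *v b)) (CARD('n) * \<sigma>\<^sup>2)"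
        by (simp only: likelihood_def matrix_vector_mul_lid vec_lambda_beta)
      then show ?thesis
        by (subst nn_integral_eq_integral) (auto simp: has_bochner_integral_iff)
    qed
    then show "(\<integral>\<^sup>+p. ennreal ((snd p - X *v fst p) \<bullet> (snd p - X *v fst p)) \<partial>J) = ennreal (CARD('n) * \<sigma>\<^sup>2)"
      unfolding J_def by (subst nn_integral_joint_given[OF lik l]) (auto simp: prior prior.emeasure_space_1[simplified])
  qed (use \<sigma> in auto)
  \<comment> \<open>Averaging over y given b leaves a quadratic form in b, with matrix X^T Q X, plus
    a constant noise term; averaging over b then produces two traces.\<close>
  have quadratic: "has_bochner_integral J (\<lambda>p. snd p \<bullet> (Q *v snd p)) (CARD('n))"
  proof (rule has_bochner_integral_nn_integral)
    let ?A = "transpose X ** (Q ** X)"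
    let ?c = "\<Sum>i\<in>UNIV. Q $ i $ i * \<sigma>\<^sup>2"
    have A: "(X *v b) \<bullet> (Q *v (X *v b)) = b \<bullet> (?A *v b)" for b
      by (metis dot_lmul_matrix matrix_vector_mul_assoc vector_transpose_matrix inner_commute)
    have "(\<integral>\<^sup>+y. ennreal (y \<bullet> (Q *v y)) \<partial>likelihood X \<sigma> b) = ennreal (b \<bullet> (?A *v b) + ?c)" for b
      using normal_vec_quadratic[of "\<chi> i. \<sigma>" "X *v b" Q] \<sigma> Q(4)
      by (subst nn_integral_eq_integral) (auto simp: likelihood_def has_bochner_integral_iff A)
    then have "(\<integral>\<^sup>+p. ennreal (snd p \<bullet> (Q *v snd p)) \<partial>J) = (\<integral>\<^sup>+b. ennreal (b \<bullet> (?A *v b) + ?c) \<partial>normal_vec 0 s)"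
      unfolding J_def by (subst nn_integral_joint_given[OF lik l]) (auto simp: prior)
    also have "\<dots> = ennreal ((\<Sum>j\<in>UNIV. ?A $ j $ j * (s $ j)\<^sup>2) + ?c)"
    proof -
      have "has_bochner_integral (normal_vec 0 s) (\<lambda>b. b \<bullet> (?A *v b) + ?c) ((\<Sum>j\<in>UNIV. ?A $ j $ j * (s $ j)\<^sup>2) + ?c)"
        using normal_vec_quadratic[OF s, of 0 ?A] prior.prob_space
        by (intro has_bochner_integral_add) (auto simp: has_bochner_integral_iff)
      moreover have "0 \<le> b \<bullet> (?A *v b) + ?c" for b
      proof -
        have "0 \<le> Q $ i $ i" for i
          using Q(4)[of "axis i 1"] by (simp add: inner_axis' matrix_vector_mult_basis column_def)
        then show ?thesis
          using Q(4)[of "X *v b"] by (auto simp: A intro!: add_nonneg_nonneg sum_nonneg)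
      qed
      ultimately show ?thesis
        by (subst nn_integral_eq_integral) (auto simp: has_bochner_integral_iff)
    qed
    also have "(\<Sum>j\<in>UNIV. ?A $ j $ j * (s $ j)\<^sup>2) + ?c = CARD('n)"
    proof -
      have "(\<Sum>j\<in>UNIV. ?A $ j $ j * (s $ j)\<^sup>2) = trace (transpose X ** (Q ** X ** Sigma_scales lam tau))"
        unfolding s_def diagonal_quadratic_trace by (simp add: matrix_mul_assoc)
      \<comment> \<open>Cyclicity of the trace moves X^T to the right end, so the two traces combine
        into the trace of \<open>Q ** C\<close>, the identity, which is n.\<close>
      also have "\<dots> = trace (Q ** (X ** Sigma_scales lam tau ** transpose X))"
        by (subst trace_mul_sym) (simp add: matrix_mul_assoc)
      finally have "(\<Sum>j\<in>UNIV. ?A $ j $ j * (s $ j)\<^sup>2) = trace (Q ** (X ** Sigma_scales lam tau ** transpose X))" .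
      moreover have "?c = trace (Q ** (\<sigma>\<^sup>2 *\<^sub>R mat 1))"
        by (simp add: matrix_scalar_ac scalar_matrix_assoc[symmetric] trace_def mult.commute)
      moreover have "trace (Q ** (X ** Sigma_scales lam tau ** transpose X)) + trace (Q ** (\<sigma>\<^sup>2 *\<^sub>R mat 1)) = trace (Q ** C)"
        by (simp add: C_def matrix_add_ldistrib trace_add)
      ultimately show ?thesis by (simp add: Q trace_I)
    qed
    finally show "(\<integral>\<^sup>+p. ennreal (snd p \<bullet> (Q *v snd p)) \<partial>J) = ennreal (CARD('n))" by simp
  qed (use Q(4) in auto)

  define c where "c = 1 / 2 * ln (det (mat 1 + (1 / \<sigma>\<^sup>2) *\<^sub>R (X ** Sigma_scales lam tau ** transpose X)))"
  \<comment> \<open>Factoring sigma^2 I out of \<open>C\<close> isolates the determinant of the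
    noise covariance; it cancels in the log ratio, and \<open>c\<close> remains.\<close>
  have detC: "det C = \<sigma> ^ (2 * CARD('n)) * det (mat 1 + (1 / \<sigma>\<^sup>2) *\<^sub>R (X ** Sigma_scales lam tau ** transpose X))"
  proof -
    have "C = (\<sigma>\<^sup>2 *\<^sub>R mat 1) ** (mat 1 + (1 / \<sigma>\<^sup>2) *\<^sub>R (X ** Sigma_scales lam tau ** transpose X))"
      using \<sigma> by (simp add: C_def scalar_matrix_assoc[symmetric] scaleR_add_right)
    then show ?thesis by (simp only: det_mul psd_scaled_identity[OF \<sigma>])
  qed
  have log_ratio: "ln (f b y / gauss C y) =
      c - (1 / (2 * \<sigma>\<^sup>2)) * ((y - X *v b) \<bullet> (y - X *v b)) + (1 / 2) * (y \<bullet> (Q *v y))" for b y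
  proof -
    have ln_gauss: "ln (gauss B z) = - (z \<bullet> (matrix_inv B *v z)) / 2 - ln ((2 * pi) ^ CARD('n) * det B) / 2"
      if "psd B" for B :: "real ^ 'n ^ 'n" and z
      using that by (simp add: gauss_def psd_def ln_div ln_sqrt)
    have "0 < det C" using C by (simp add: psd_def)
    then have "0 < det (mat 1 + (1 / \<sigma>\<^sup>2) *\<^sub>R (X ** Sigma_scales lam tau ** transpose X))"
      using \<sigma> by (simp add: detC zero_less_mult_iff)
    then have "ln ((2 * pi) ^ CARD('n) * det C) / 2 - ln ((2 * pi) ^ CARD('n) * det (\<sigma>\<^sup>2 *\<^sub>R mat 1 :: real ^ 'n ^ 'n)) / 2 = c"
      using \<sigma> by (simp add: detC psd_scaled_identity(1) c_def ln_mult field_simps)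
    moreover have "ln (f b y / gauss C y) = ln (f b y) - ln (gauss C y)"
      using f_pos[of b y] gauss_pos[OF C, of y] by (simp add: ln_div)
    moreover have "(y - X *v b) \<bullet> (matrix_inv (\<sigma>\<^sup>2 *\<^sub>R mat 1) *v (y - X *v b)) =
        2 * ((1 / (2 * \<sigma>\<^sup>2)) * ((y - X *v b) \<bullet> (y - X *v b)))"
      by (simp add: psd_scaled_identity(3)[OF \<sigma>] scaleR_matrix_vector_assoc[symmetric]
          del: real_scaleR_def scaleR_diff_right inner_diff_left inner_diff_right)
    ultimately show ?thesis
      unfolding f_def gaussian_kernel_def ln_gauss[OF C] ln_gauss[OF psd_scaled_identity(2)[OF \<sigma>]] Q_def
      by linarith
  qed
  \<comment> \<open>The residual contributes -n/2 and the form in \<open>Q\<close> contributes n/2,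
    so the expected log ratio is \<open>c\<close>.\<close>
  have "has_bochner_integral J (\<lambda>p. ln (f (fst p) (snd p) / gauss C (snd p)))
      (c - (1 / (2 * \<sigma>\<^sup>2)) * (CARD('n) * \<sigma>\<^sup>2) + (1 / 2) * CARD('n))"
    unfolding log_ratio using J.prob_space
    by (intro has_bochner_integral_add has_bochner_integral_diff has_bochner_integral_mult_right residual quadratic)
      (auto simp: has_bochner_integral_iff)
  then have "has_bochner_integral J (\<lambda>p. ln (f (fst p) (snd p) / gauss C (snd p))) c"
    using \<sigma> by simp
  then have int: "integrable J (\<lambda>p. ln (f (fst p) (snd p) / gauss C (snd p)))"
    and c: "(\<integral>p. ln (f (fst p) (snd p) / gauss C (snd p)) \<partial>J) = c"
    by (auto simp: has_bochner_integral_iff)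
  \<comment> \<open>Integrability makes both parts finite, so p = I + n determines the information
    as p - n = \<open>c\<close>. Nonnegativity matters because \<open>e2ennreal\<close> would
    truncate negative values to 0.\<close>
  define p where "p = (\<integral>\<^sup>+p. ennreal (ln (f (fst p) (snd p) / gauss C (snd p))) \<partial>J)"
  define n where "n = (\<integral>\<^sup>+p. ennreal (- ln (f (fst p) (snd p) / gauss C (snd p))) \<partial>J)"
  have "c = enn2real p - enn2real n" and fin: "p \<noteq> \<infinity>" "n \<noteq> \<infinity>"
    using int c by (simp_all add: real_lebesgue_integral_def real_integrable_def p_def n_def)
  moreover have eq: "p = e2ennreal (mutual_info J borel borel fst snd) + n" and nonneg: "0 \<le> mutual_info J borel borel fst snd"
    using mi(1,2) by (simp_all add: p_def n_def)
  moreover obtain a b d where "0 \<le> a" "p = ennreal a" "0 \<le> b" "n = ennreal b"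
      "0 \<le> d" "e2ennreal (mutual_info J borel borel fst snd) = ennreal d"
    using fin eq by (cases p; cases n; cases "e2ennreal (mutual_info J borel borel fst snd)") auto
  ultimately have "c = d" "mutual_info J borel borel fst snd = enn2ereal (ennreal d)"
    using enn2ereal_e2ennreal[of "mutual_info J borel borel fst snd"] by (auto simp flip: ennreal_plus)
  then show ?thesis
    using \<open>0 \<le> d\<close> by (simp add: J_def c_def)
qed

text \<open>The first conjunct gives the second its meaning: \<open>joint_given\<close> is a version
  of the conditional law of (\<beta>, Y) given L, and for this version the closed form holds at
  every admissible value of the scales, not only almost everywhere.\<close>

theorem mainTheorem8:
  fixes M :: "'o measure"
    and X :: "real ^ 'p ^ 'n"
    and \<sigma> :: real
    and L :: "'o \<Rightarrow> (real ^ 'p) \<times> real"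
    and \<beta> :: "'o \<Rightarrow> real ^ 'p"
    and Y :: "'o \<Rightarrow> real ^ 'n"
  assumes "prob_space M"
    and "\<sigma> > 0"
    and "L \<in> M \<rightarrow>\<^sub>M scale_space"
    and "\<beta> \<in> M \<rightarrow>\<^sub>M borel"
    and "Y \<in> M \<rightarrow>\<^sub>M borel"
    and "cond_law M scale_space borel L \<beta> prior"
    and "cond_law M (scale_space \<Otimes>\<^sub>M borel) borel (\<lambda>x. (L x, \<beta> x)) Y (\<lambda>(l, b). likelihood X \<sigma> b)"
  shows "cond_law M scale_space (borel \<Otimes>\<^sub>M borel) L (\<lambda>x. (\<beta> x, Y x)) (joint_given X \<sigma>)
    \<and> (\<forall>lam tau. (lam, tau) \<in> space scale_space \<longrightarrow>
        mutual_info (joint_given X \<sigma> (lam, tau)) borel borel fst snd =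
        ereal (1 / 2 * ln (det (mat 1 + (1 / \<sigma>\<^sup>2) *\<^sub>R (X ** Sigma_scales lam tau ** transpose X)))))
    \<and> mutual_info M borel borel \<beta> Y =
        mutual_info M scale_space borel L Y + cond_mutual_info M borel borel scale_space \<beta> Y L"
proof (intro conjI allI impI)
  note [measurable] = assms(3-5)
  interpret M: prob_space M by fact
  \<comment> \<open>Measurability of the likelihood kernel in b is extracted from the hypothesis on
    Y by fixing one attained value of L.\<close>
  obtain \<omega> where "\<omega> \<in> space M" using M.not_empty by auto
  then have "L \<omega> \<in> space scale_space" by (rule measurable_space[OF assms(3)])
  from measurable_Pair2[OF assms(7)[unfolded cond_law_def, THEN conjunct1] this]
  have lik: "likelihood X \<sigma> \<in> borel \<rightarrow>\<^sub>M prob_algebra borel" by simp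
  show "cond_law M scale_space (borel \<Otimes>\<^sub>M borel) L (\<lambda>x. (\<beta> x, Y x)) (joint_given X \<sigma>)"
    using cond_law_pair[OF assms(6) assms(7) assms(1) assms(3-5)] by (simp add: joint_given_def[abs_def])
  show "mutual_info (joint_given X \<sigma> (lam, tau)) borel borel fst snd =
      ereal (1 / 2 * ln (det (mat 1 + (1 / \<sigma>\<^sup>2) *\<^sub>R (X ** Sigma_scales lam tau ** transpose X))))"
    if "(lam, tau) \<in> space scale_space" for lam tau
    using assms(2) lik that by (rule mutual_info_joint_given)
  show "mutual_info M borel borel \<beta> Y =
      mutual_info M scale_space borel L Y + cond_mutual_info M borel borel scale_space \<beta> Y L"
    using assms(7) unfolding likelihood_eq_density[OF assms(2)]
    by (intro mutual_info_chain_rule[OF assms(1,3-5) sigma_finite_lborel sets_lborel gaussian_kernel_measurable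
        gaussian_kernel_pos[OF assms(2)] gaussian_kernel_bounded[OF assms(2)] assms(6)])
qed

end
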